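(* Let $E$ be an infinite-dimensional (IV)-polyhedral real Banach space, let $\varepsilon>0$, and let the Banach space $X$ and the set $\mathcal{B}\subset B_{X^*}$ be obtained from $E$ and $\varepsilon$ by the construction described in the context. Then $\mathcal{B}$ satisfies property (V), that is, $$\sup\{f(x): f\in\mathcal{B}\setminus D_X(x)\}<1\qquad\text{for each } x\in S_X,$$ and hence $X$ is a (V)-polyhedral Banach space.
   Context: **Notation.** For a real Banach space $E$: $B_E$, $S_E$ are the closed unit ball and unit sphere; $\mathrm{ext}(K)$ is the set of extreme points of $K$; $\overline{\mathrm{conv}}$ is the norm-closed convex hull; $\mathrm{dens}(E)$ is the density character. For $x\in S_E$, $D_E(x)=\{x^*\in S_{E^*}: x^*(x)=1\}$. For $\mathcal{A}\subset E^*$, $\mathcal{A}'$ is the set of $w^*$-cluster (accumulation) points of $\mathcal{A}$. **Polyhedrality.** $E$ is polyhedral if the unit ball of each finite-dimensional subspace is a polytope (convex hull of finitely many points). $E$ is (IV)-polyhedral if $f(x)<1$ whenever $x\in S_E$ and $f\in(\mathrm{ext}\,B_{E^*})'$. $E$ is (V)-polyhedral if $\sup\{f(x): f\in\mathrm{ext}\,B_{E^*}\setminus D_E(x)\}<1$ for each $x\in S_E$. **True faces.** A set $F\subset S_E$ is a true face of $B_E$ if there is $f\in S_{E^*}$ such that, with $H=f^{-1}(1)$, $F=H\cap B_E$ and the relative interior $\mathrm{int}_H F$ of $F$ in $H$ is nonempty. If $E$ is an infinite-dimensional polyhedral space, the minimal boundary of $E$ is $\mathcal{B}_0=\{f\in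 S_{E^*}: f^{-1}(1)\cap B_E \text{ is a true face of } B_E\}$; it is known that for each $x\in E$ some $f\in\mathcal{B}_0$ satisfies $f(x)=\|x\|$, and that $\mathrm{card}(\mathcal{B}_0)=\mathrm{dens}(E)=\mathrm{dens}(E^* )$. **Property $( ** )$.** A polyhedral space $E$ satisfies $( ** )$ if $\sup\{f(x): f\in\mathcal{B}_0\setminus D_E(x)\}<1$ for every $x\in S_E$ at which the norm of $E$ is Fréchet differentiable. It is known that every (IV)-polyhedral space is (V)-polyhedral and that every (V)-polyhedral space is polyhedral and satisfies $( ** )$. **Construction of $X$.** Let $E$ be infinite-dimensional, polyhedral, with $( ** )$, norm $\|\cdot\|$, and $\varepsilon>0$. Let $\Gamma=\mathrm{card}(\mathcal{B}_0)$, an infinite cardinal identified with the interval of ordinals $[0,\Gamma)$. Write $\mathcal{B}_0$ as the disjoint union of $\{f^+_\gamma\}_{\gamma<\Gamma}$ and $\{f^-_\gamma\}_{\gamma<\Gamma}$ (without repetitions) with $f^-_\gamma=-f^+_\gamma$; put $H^\pm_\gamma=(f^\pm_\gamma)^{-1}(1)$, $S^\pm_\gamma=H^\pm_\gamma\cap B_E$. Fix $\theta:[0,\Gamma)\to(0,\varepsilon)$ with $\inf_{\gamma\ge\eta}\theta(\gamma)=0$ for every $\eta<\Gamma$, and a family $\{x_\gamma\}_{\gamma<\Gamma}$ dense in $B_E$. Let $J=(0,\omega)$ if $\Gamma=\omega$ and $J=(\omega,\Gamma)$ if $\Gamma>\omega$. By (transfinite) induction on $\gamma\in J$ do the following (all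 choices are possible). Let $W^\gamma=\{x_\eta:\eta<\gamma\}\cup\bigcup_{\delta\in J,\,\delta<\gamma}E_\delta$. If $\Gamma=\omega$, $W^\gamma$ is finite and we enumerate it as $\{z^\gamma_\eta\}_{\eta<\kappa_\gamma}$ with $\kappa_\gamma$ a positive integer; if $\Gamma>\omega$, $\mathrm{card}(W^\gamma)=\mathrm{card}(\gamma)$ and we enumerate it as $\{z^\gamma_\eta\}_{\eta<\kappa_\gamma}$ with $\kappa_\gamma=\gamma$. By induction on $\eta<\kappa_\gamma$ choose a finite nonempty set $A^\gamma_\eta\subset[0,\Gamma)$ disjoint from $\bigcup_{\delta\in J,\delta<\gamma}A_\delta\cup\bigcup_{v<\eta}A^\gamma_v$ and, for each $w\in A^\gamma_\eta$, points $e^+_w\in\mathrm{int}_{H^+_w}(S^+_w)$, $e^-_w\in\mathrm{int}_{H^-_w}(S^-_w)$ and numbers $\lambda^+_w,\lambda^-_w\ge0$ with $\sum_{w\in A^\gamma_\eta}(\lambda^+_w+\lambda^-_w)=1$ and $$z^\gamma_\eta\in\sum_{w\in A^\gamma_\eta}(\lambda^+_we^+_w+\lambda^-_we^-_w)+\theta(\gamma)B_E .$$ Set $A_\gamma=\bigcup_{\eta<\kappa_\gamma}A^\gamma_\eta$ and $E_\gamma=\{e^+_w,e^-_w: w\in A_\gamma\}$. Finally let $A=\bigcup_{\gamma\in J}A_\gamma$ and, for $\gamma<\Gamma$, let $e_\gamma=e^+_\gamma$ if $\gamma\in A$ and $\lambda^+_\gamma\ge\lambda^-_\gamma$; $e_\gamma=-e^-_\gamma$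 if $\gamma\in A$ and $\lambda^+_\gamma<\lambda^-_\gamma$; and $e_\gamma$ an arbitrary element of $\mathrm{int}_{H^+_\gamma}(S^+_\gamma)$ if $\gamma\notin A$. By $( ** )$, $\mu_\gamma:=\sup_{\xi\ne\gamma}|f^+_\xi(e_\gamma)|<1$; choose $\theta_\gamma\in(0,\varepsilon)$ with $\theta_\gamma+\mu_\gamma+\theta_\gamma\mu_\gamma<1$. Put $$B=\overline{\mathrm{conv}}\bigl(\{\pm(1+\theta_\gamma)e_\gamma:\gamma\in[0,\Gamma)\}\bigr).$$ One has $B_E\subset B\subset(1+\varepsilon)B_E$; $X$ is $E$ with the equivalent norm whose closed unit ball is $B_X=B$. **The set $\mathcal{B}$.** For $\gamma\in[0,\Gamma)$ and $\xi\in[0,\Gamma)\setminus\{\gamma\}$ one has $f^+_\gamma((1+\theta_\gamma)e_\gamma)=1+\theta_\gamma>1$ and $f^\pm_\xi((1+\theta_\gamma)e_\gamma)<1$, so there are unique $\lambda^+_{\xi,\gamma},\lambda^-_{\xi,\gamma}\in(0,1)$ such that $g^+_{\xi,\gamma}:=(1-\lambda^+_{\xi,\gamma})f^+_\xi+\lambda^+_{\xi,\gamma}f^+_\gamma$ and $g^-_{\xi,\gamma}:=(1-\lambda^-_{\xi,\gamma})f^-_\xi+\lambda^-_{\xi,\gamma}f^+_\gamma$ satisfy $g^\pm_{\xi,\gamma}((1+\theta_\gamma)e_\gamma)=1$. Put $\mathcal{B}=\{\pm g^+_{\xi,\gamma},\pm g^-_{\xi,\gamma}:\gamma\in[0,\Gamma),\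 \xi\in[0,\Gamma)\setminus\{\gamma\}\}$; it is contained in $B_{X^*}$. *)

theory Defs
  imports "HOL-Analysis.Analysis"
begin

unbundle cardinal_syntax

text \<open>
  A renorming of a Banach space is represented by a norm \<open>N\<close>, given as a function on the
  type that carries the original norm \<open>norm\<close>.  As long as \<open>N\<close> is equivalent to \<open>norm\<close>,
  the type \<open>'a \<Rightarrow>\<^sub>L real\<close> is the topological dual for both norms; only the dual norm
  depends on \<open>N\<close>.  The original space is the case \<open>N = norm\<close>.
\<close>

definition is_norm :: "('a::real_vector \<Rightarrow> real) \<Rightarrow> bool" where
  "is_norm N \<longleftrightarrow>
     (\<forall>x. N x = 0 \<longleftrightarrow> x = 0) \<and>
     (\<forall>c x. N (c *\<^sub>R x) = \<bar>c\<bar> * N x) \<and>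
     (\<forall>x y. N (x + y) \<le> N x + N y)"

definition is_banach_norm :: "('a::real_vector \<Rightarrow> real) \<Rightarrow> bool" where
  "is_banach_norm N \<longleftrightarrow> is_norm N \<and> Metric_space.mcomplete UNIV (\<lambda>x y. N (x - y))"

definition equivalent_norm :: "('a::real_normed_vector \<Rightarrow> real) \<Rightarrow> bool" where
  "equivalent_norm N \<longleftrightarrow>
     is_norm N \<and> (\<exists>c>0. \<exists>C>0. \<forall>x. c * norm x \<le> N x \<and> N x \<le> C * norm x)"

definition dual_norm :: "('a::real_normed_vector \<Rightarrow> real) \<Rightarrow> ('a \<Rightarrow>\<^sub>L real) \<Rightarrow> real" where
  "dual_norm N f = (SUP x\<in>{x. N x \<le> 1}. \<bar>blinfun_apply f x\<bar>)"

definition dual_ball :: "('a::real_normed_vector \<Rightarrow> real) \<Rightarrow> ('a \<Rightarrow>\<^sub>L real) set" where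
  "dual_ball N = {f. dual_norm N f \<le> 1}"

definition ext_dual_ball :: "('a::real_normed_vector \<Rightarrow> real) \<Rightarrow> ('a \<Rightarrow>\<^sub>L real) set" where
  "ext_dual_ball N = {f. f extreme_point_of dual_ball N}"

text \<open>The set \<open>D(x)\<close> of norm-one functionals attaining the value 1 at \<open>x\<close>.\<close>

definition duality_set :: "('a::real_normed_vector \<Rightarrow> real) \<Rightarrow> 'a \<Rightarrow> ('a \<Rightarrow>\<^sub>L real) set" where
  "duality_set N x = {f. dual_norm N f = 1 \<and> blinfun_apply f x = 1}"

text \<open>On \<open>'a \<Rightarrow>\<^sub>L real\<close> the strong operator topology is the weak-star topology.\<close>

abbreviation weak_star :: "('a::real_normed_vector \<Rightarrow>\<^sub>L real) topology" where
  "weak_star \<equiv> strong_operator_topology"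

definition IV_polyhedral :: "('a::real_normed_vector \<Rightarrow> real) \<Rightarrow> bool" where
  "IV_polyhedral N \<longleftrightarrow>
     (\<forall>x f. N x = 1 \<longrightarrow> f \<in> weak_star derived_set_of (ext_dual_ball N) \<longrightarrow> blinfun_apply f x < 1)"

text \<open>The supremum is taken in the extended reals, so that the supremum over the empty set is
  \<open>-\<infinity>\<close> and that of an unbounded set is \<open>\<infinity>\<close>.\<close>

definition property_V :: "('a::real_normed_vector \<Rightarrow> real) \<Rightarrow> ('a \<Rightarrow>\<^sub>L real) set \<Rightarrow> bool" where
  "property_V N \<A> \<longleftrightarrow>
     (\<forall>x. N x = 1 \<longrightarrow> (SUP f \<in> \<A> - duality_set N x. ereal (blinfun_apply f x)) < 1)"

definition V_polyhedral :: "('a::real_normed_vector \<Rightarrow> real) \<Rightarrow> bool" where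
  "V_polyhedral N \<longleftrightarrow> property_V N (ext_dual_ball N)"

lemma dual_norm_norm: "dual_norm norm f = norm f"
proof (rule antisym)
  have ub: "\<bar>blinfun_apply f x\<bar> \<le> norm f" if "norm x \<le> 1" for x
    using norm_blinfun[of f x] that
    by (metis mult.right_neutral mult_left_mono norm_ge_zero order_trans real_norm_def)
  then show "dual_norm norm f \<le> norm f"
    unfolding dual_norm_def by (intro cSUP_least) (auto intro: exI[of _ 0])
  have bdd: "bdd_above ((\<lambda>x. \<bar>blinfun_apply f x\<bar>) ` {x. norm x \<le> 1})"
    using ub by (auto intro!: bdd_aboveI2)
  have le: "\<bar>blinfun_apply f x\<bar> \<le> dual_norm norm f" if "norm x \<le> 1" for x
    unfolding dual_norm_def by (rule cSUP_upper[OF _ bdd]) (use that in auto)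
  have nn: "0 \<le> dual_norm norm f" using le[of 0] by simp
  show "norm f \<le> dual_norm norm f"
  proof (rule norm_blinfun_bound[OF nn])
    fix x
    show "norm (blinfun_apply f x) \<le> dual_norm norm f * norm x"
    proof (cases "x = 0")
      case False
      then have "\<bar>blinfun_apply f (x /\<^sub>R norm x)\<bar> \<le> dual_norm norm f" by (intro le) simp
      with False show ?thesis by (simp add: blinfun.scaleR_right abs_mult field_simps)
    qed simp
  qed
qed

lemma dual_ball_norm: "dual_ball norm = cball 0 1"
  by (auto simp: dual_ball_def dual_norm_norm)


section \<open>True faces and the minimal boundary\<close>

definition face :: "('a::real_normed_vector \<Rightarrow>\<^sub>L real) \<Rightarrow> 'a set" where
  "face f = {x. blinfun_apply f x = 1} \<inter> cball 0 1"

text \<open>The interior of \<open>face f\<close> relative to the hyperplane \<open>f = 1\<close>.\<close>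

definition face_interior :: "('a::real_normed_vector \<Rightarrow>\<^sub>L real) \<Rightarrow> 'a set" where
  "face_interior f = (top_of_set {x. blinfun_apply f x = 1}) interior_of (face f)"

definition true_face :: "'a::real_normed_vector set \<Rightarrow> bool" where
  "true_face F \<longleftrightarrow>
     F \<subseteq> sphere 0 1 \<and> (\<exists>f. norm f = 1 \<and> F = face f \<and> face_interior f \<noteq> {})"

definition minimal_boundary :: "('a::real_normed_vector \<Rightarrow>\<^sub>L real) set" where
  "minimal_boundary = {f. norm f = 1 \<and> true_face (face f)}"


section \<open>The construction\<close>

text \<open>
  The interval of ordinals \<open>[0,\<Gamma>)\<close> is represented by a cardinal order \<open>r\<close> (a well-order
  whose order type is an initial ordinal): its elements are those of \<open>Field r\<close>,
  \<open>underS r \<gamma>\<close> is \<open>[0,\<gamma>)\<close> and \<open>above r \<gamma>\<close> is \<open>[\<gamma>,\<Gamma>)\<close>.  When \<open>\<Gamma> > \<omega>\<close>, the element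
  \<open>\<delta>\<close> of \<open>Field r\<close> that is the ordinal \<open>\<omega>\<close> is recognised by the order type of \<open>[0,\<delta>)\<close>.
\<close>

definition index_J :: "'i rel \<Rightarrow> 'i set" where
  "index_J r =
     (if r =o natLeq then {\<gamma> \<in> Field r. underS r \<gamma> \<noteq> {}}
      else {\<gamma> \<in> Field r. \<exists>\<delta> \<in> underS r \<gamma>. Restr r (underS r \<delta>) =o natLeq})"

text \<open>In the following, \<open>A \<gamma> \<eta>\<close> is \<open>A\<^sup>\<gamma>\<^sub>\<eta>\<close>, \<open>set_A r \<kappa> A \<gamma>\<close> is \<open>A\<^sub>\<gamma>\<close>, \<open>set_E\<close> and \<open>set_W\<close> are
  \<open>E\<^sub>\<gamma>\<close> and \<open>W\<^sup>\<gamma>\<close>, and \<open>ep\<close>, \<open>em\<close> are \<open>e\<^sup>+\<close>, \<open>e\<^sup>-\<close>.\<close>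

definition set_A :: "'i rel \<Rightarrow> ('i \<Rightarrow> 'i) \<Rightarrow> ('i \<Rightarrow> 'i \<Rightarrow> 'i set) \<Rightarrow> 'i \<Rightarrow> 'i set" where
  "set_A r \<kappa> A \<gamma> = (\<Union>\<eta> \<in> underS r (\<kappa> \<gamma>). A \<gamma> \<eta>)"

definition set_E ::
  "'i rel \<Rightarrow> ('i \<Rightarrow> 'i) \<Rightarrow> ('i \<Rightarrow> 'i \<Rightarrow> 'i set) \<Rightarrow> ('i \<Rightarrow> 'a) \<Rightarrow> ('i \<Rightarrow> 'a) \<Rightarrow> 'i \<Rightarrow> 'a set" where
  "set_E r \<kappa> A ep em \<gamma> = ep ` set_A r \<kappa> A \<gamma> \<union> em ` set_A r \<kappa> A \<gamma>"

definition set_W ::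
  "'i rel \<Rightarrow> ('i \<Rightarrow> 'a) \<Rightarrow> ('i \<Rightarrow> 'i) \<Rightarrow> ('i \<Rightarrow> 'i \<Rightarrow> 'i set) \<Rightarrow> ('i \<Rightarrow> 'a) \<Rightarrow> ('i \<Rightarrow> 'a)
     \<Rightarrow> 'i \<Rightarrow> 'a set" where
  "set_W r x \<kappa> A ep em \<gamma> =
     x ` underS r \<gamma> \<union> (\<Union>\<delta> \<in> index_J r \<inter> underS r \<gamma>. set_E r \<kappa> A ep em \<delta>)"

definition set_A_total :: "'i rel \<Rightarrow> ('i \<Rightarrow> 'i) \<Rightarrow> ('i \<Rightarrow> 'i \<Rightarrow> 'i set) \<Rightarrow> 'i set" where
  "set_A_total r \<kappa> A = (\<Union>\<gamma> \<in> index_J r. set_A r \<kappa> A \<gamma>)"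

definition mu :: "'i rel \<Rightarrow> ('i \<Rightarrow> 'a::real_normed_vector \<Rightarrow>\<^sub>L real) \<Rightarrow> ('i \<Rightarrow> 'a) \<Rightarrow> 'i \<Rightarrow> real" where
  "mu r fp e \<gamma> = (SUP \<xi> \<in> Field r - {\<gamma>}. \<bar>blinfun_apply (fp \<xi>) (e \<gamma>)\<bar>)"

text \<open>
  All the choices made in the construction, with the conditions imposed on them:
  \<open>fp\<close>, \<open>fm\<close> are \<open>f\<^sup>+\<close>, \<open>f\<^sup>-\<close>; \<open>\<theta>\<close> is the function \<open>[0,\<Gamma>) \<rightarrow> (0,\<epsilon>)\<close> and \<open>\<tau> \<gamma>\<close> is the
  number \<open>\<theta>\<^sub>\<gamma>\<close>; \<open>lp\<close>, \<open>lm\<close> are \<open>\<lambda>\<^sup>+\<close>, \<open>\<lambda>\<^sup>-\<close>.  The enumerations \<open>z \<gamma>\<close> of \<open>W\<^sup>\<gamma>\<close> are allowed to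
  have repetitions.
\<close>

locale renorming_construction =
  fixes \<epsilon> :: real
    and r :: "'i rel"
    and fp fm :: "'i \<Rightarrow> 'a::banach \<Rightarrow>\<^sub>L real"
    and \<theta> :: "'i \<Rightarrow> real"
    and x :: "'i \<Rightarrow> 'a"
    and \<kappa> :: "'i \<Rightarrow> 'i"
    and z :: "'i \<Rightarrow> 'i \<Rightarrow> 'a"
    and A :: "'i \<Rightarrow> 'i \<Rightarrow> 'i set"
    and ep em :: "'i \<Rightarrow> 'a"
    and lp lm :: "'i \<Rightarrow> real"
    and e :: "'i \<Rightarrow> 'a"
    and \<tau> :: "'i \<Rightarrow> real"
  assumes card_order: "Card_order r"
    and card_boundary: "r =o |minimal_boundary :: ('a \<Rightarrow>\<^sub>L real) set|"
    and boundary_split: "minimal_boundary = fp ` Field r \<union> fm ` Field r"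
    and boundary_disjoint: "fp ` Field r \<inter> fm ` Field r = {}"
    and inj_fp: "inj_on fp (Field r)"
    and inj_fm: "inj_on fm (Field r)"
    and fm_eq: "\<And>\<gamma>. \<gamma> \<in> Field r \<Longrightarrow> fm \<gamma> = - fp \<gamma>"
    and theta_range: "\<And>\<gamma>. \<gamma> \<in> Field r \<Longrightarrow> 0 < \<theta> \<gamma> \<and> \<theta> \<gamma> < \<epsilon>"
    and theta_inf: "\<And>\<eta>. \<eta> \<in> Field r \<Longrightarrow> (INF \<gamma> \<in> above r \<eta>. \<theta> \<gamma>) = 0"
    and x_in_ball: "x ` Field r \<subseteq> cball 0 1"
    and x_dense: "cball 0 1 \<subseteq> closure (x ` Field r)"
    and kappa: "\<And>\<gamma>. \<gamma> \<in> index_J r \<Longrightarrow>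
          if r =o natLeq then \<kappa> \<gamma> \<in> Field r \<and> underS r (\<kappa> \<gamma>) \<noteq> {} else \<kappa> \<gamma> = \<gamma>"
    and z_enum: "\<And>\<gamma>. \<gamma> \<in> index_J r \<Longrightarrow>
          z \<gamma> ` underS r (\<kappa> \<gamma>) = set_W r x \<kappa> A ep em \<gamma>"
    and A_finite: "\<And>\<gamma> \<eta>. \<gamma> \<in> index_J r \<Longrightarrow> \<eta> \<in> underS r (\<kappa> \<gamma>) \<Longrightarrow>
          finite (A \<gamma> \<eta>) \<and> A \<gamma> \<eta> \<noteq> {} \<and> A \<gamma> \<eta> \<subseteq> Field r"
    and A_disjoint: "\<And>\<gamma> \<eta>. \<gamma> \<in> index_J r \<Longrightarrow> \<eta> \<in> underS r (\<kappa> \<gamma>) \<Longrightarrow>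
          A \<gamma> \<eta> \<inter> ((\<Union>\<delta> \<in> index_J r \<inter> underS r \<gamma>. set_A r \<kappa> A \<delta>)
                    \<union> (\<Union>v \<in> underS r \<eta>. A \<gamma> v)) = {}"
    and e_interior: "\<And>\<gamma> \<eta> w. \<gamma> \<in> index_J r \<Longrightarrow> \<eta> \<in> underS r (\<kappa> \<gamma>) \<Longrightarrow> w \<in> A \<gamma> \<eta> \<Longrightarrow>
          ep w \<in> face_interior (fp w) \<and> em w \<in> face_interior (fm w)"
    and l_nonneg: "\<And>\<gamma> \<eta> w. \<gamma> \<in> index_J r \<Longrightarrow> \<eta> \<in> underS r (\<kappa> \<gamma>) \<Longrightarrow> w \<in> A \<gamma> \<eta> \<Longrightarrow>
          0 \<le> lp w \<and> 0 \<le> lm w"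
    and l_sum: "\<And>\<gamma> \<eta>. \<gamma> \<in> index_J r \<Longrightarrow> \<eta> \<in> underS r (\<kappa> \<gamma>) \<Longrightarrow>
          (\<Sum>w \<in> A \<gamma> \<eta>. lp w + lm w) = 1"
    and z_approx: "\<And>\<gamma> \<eta>. \<gamma> \<in> index_J r \<Longrightarrow> \<eta> \<in> underS r (\<kappa> \<gamma>) \<Longrightarrow>
          z \<gamma> \<eta> \<in> cball (\<Sum>w \<in> A \<gamma> \<eta>. lp w *\<^sub>R ep w + lm w *\<^sub>R em w) (\<theta> \<gamma>)"
    and e_plus: "\<And>\<gamma>. \<gamma> \<in> set_A_total r \<kappa> A \<Longrightarrow> lm \<gamma> \<le> lp \<gamma> \<Longrightarrow> e \<gamma> = ep \<gamma>"
    and e_minus: "\<And>\<gamma>. \<gamma> \<in> set_A_total r \<kappa> A \<Longrightarrow> lp \<gamma> < lm \<gamma> \<Longrightarrow> e \<gamma> = - em \<gamma>"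
    and e_other: "\<And>\<gamma>. \<gamma> \<in> Field r - set_A_total r \<kappa> A \<Longrightarrow> e \<gamma> \<in> face_interior (fp \<gamma>)"
    and tau_range: "\<And>\<gamma>. \<gamma> \<in> Field r \<Longrightarrow> 0 < \<tau> \<gamma> \<and> \<tau> \<gamma> < \<epsilon>"
    and tau_mu: "\<And>\<gamma>. \<gamma> \<in> Field r \<Longrightarrow> \<tau> \<gamma> + mu r fp e \<gamma> + \<tau> \<gamma> * mu r fp e \<gamma> < 1"

definition new_ball :: "'i rel \<Rightarrow> ('i \<Rightarrow> 'a::real_normed_vector) \<Rightarrow> ('i \<Rightarrow> real) \<Rightarrow> 'a set" where
  "new_ball r e \<tau> =
     closure (convex hull
       ((\<lambda>\<gamma>. (1 + \<tau> \<gamma>) *\<^sub>R e \<gamma>) ` Field r \<union> (\<lambda>\<gamma>. - ((1 + \<tau> \<gamma>) *\<^sub>R e \<gamma>)) ` Field r))"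

definition minkowski_gauge :: "'a::real_vector set \<Rightarrow> 'a \<Rightarrow> real" where
  "minkowski_gauge K y = Inf {t. 0 < t \<and> y \<in> (\<lambda>u. t *\<^sub>R u) ` K}"

definition new_norm :: "'i rel \<Rightarrow> ('i \<Rightarrow> 'a::real_normed_vector) \<Rightarrow> ('i \<Rightarrow> real) \<Rightarrow> 'a \<Rightarrow> real" where
  "new_norm r e \<tau> = minkowski_gauge (new_ball r e \<tau>)"

text \<open>The convex combination of \<open>f\<close> and \<open>g\<close> with coefficients in \<open>(0,1)\<close> taking the value 1
  at \<open>p\<close>; it exists and is unique when \<open>f p < 1 < g p\<close>.\<close>

definition combination_at ::
  "('a::real_normed_vector \<Rightarrow>\<^sub>L real) \<Rightarrow> ('a \<Rightarrow>\<^sub>L real) \<Rightarrow> 'a \<Rightarrow> ('a \<Rightarrow>\<^sub>L real)" where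
  "combination_at f g p =
     (let c = (THE c. 0 < c \<and> c < 1 \<and> blinfun_apply ((1 - c) *\<^sub>R f + c *\<^sub>R g) p = 1)
      in (1 - c) *\<^sub>R f + c *\<^sub>R g)"

definition g_plus ::
  "('i \<Rightarrow> 'a::real_normed_vector \<Rightarrow>\<^sub>L real) \<Rightarrow> ('i \<Rightarrow> 'a) \<Rightarrow> ('i \<Rightarrow> real) \<Rightarrow> 'i \<Rightarrow> 'i \<Rightarrow> ('a \<Rightarrow>\<^sub>L real)"
  where "g_plus fp e \<tau> \<xi> \<gamma> = combination_at (fp \<xi>) (fp \<gamma>) ((1 + \<tau> \<gamma>) *\<^sub>R e \<gamma>)"

definition g_minus ::
  "('i \<Rightarrow> 'a::real_normed_vector \<Rightarrow>\<^sub>L real) \<Rightarrow> ('i \<Rightarrow> 'a \<Rightarrow>\<^sub>L real) \<Rightarrow> ('i \<Rightarrow> 'a) \<Rightarrow> ('i \<Rightarrow> real)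
     \<Rightarrow> 'i \<Rightarrow> 'i \<Rightarrow> ('a \<Rightarrow>\<^sub>L real)"
  where "g_minus fp fm e \<tau> \<xi> \<gamma> = combination_at (fm \<xi>) (fp \<gamma>) ((1 + \<tau> \<gamma>) *\<^sub>R e \<gamma>)"

definition new_functionals ::
  "'i rel \<Rightarrow> ('i \<Rightarrow> 'a::real_normed_vector \<Rightarrow>\<^sub>L real) \<Rightarrow> ('i \<Rightarrow> 'a \<Rightarrow>\<^sub>L real) \<Rightarrow> ('i \<Rightarrow> 'a)
     \<Rightarrow> ('i \<Rightarrow> real) \<Rightarrow> ('a \<Rightarrow>\<^sub>L real) set" where
  "new_functionals r fp fm e \<tau> =
     (\<Union>\<gamma> \<in> Field r. \<Union>\<xi> \<in> Field r - {\<gamma>}.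
        {g_plus fp e \<tau> \<xi> \<gamma>, - g_plus fp e \<tau> \<xi> \<gamma>, g_minus fp fm e \<tau> \<xi> \<gamma>, - g_minus fp fm e \<tau> \<xi> \<gamma>})"

end

theory Submission
  imports Defs
begin

text \<open>
  Each point \<open>x\<close> of the sphere of \<open>E\<close> lies on finitely many facets, the other functionals of the
  minimal boundary staying at most \<open>\<rho> < 1\<close> there: this is what (IV) gives by \<open>w\<^sup>*\<close>-compactness.
  In the construction at least half of the weight of each approximating combination falls on
  vectors \<open>\<plusminus>e\<^sub>w\<close>, so iterating the approximation shows \<open>B\<^sub>E \<subseteq> B\<close>.  Since
  \<open>(1 + \<theta>\<^sub>\<gamma>)(1 + \<mu>\<^sub>\<gamma>) < 2\<close>, each vertex \<open>(1 + \<theta>\<^sub>\<gamma>)e\<^sub>\<gamma>\<close> sees only its own facet, and \<open>B\<close> is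
  \<open>B\<^sub>E\<close> with a pyramid glued onto every facet; its sides are the functionals \<open>g\<^sup>\<plusminus>\<^sub>\<xi>\<^sub>,\<^sub>\<gamma>\<close>, with weight
  above \<open>1/2\<close> on \<open>f\<^sub>\<gamma>\<close>.  A point of \<open>S\<^sub>X\<close> either lies in one pyramid, or in \<open>S\<^sub>E\<close> on finitely many
  facets; in both cases only finitely many \<open>\<gamma>\<close> can produce values near 1, and the gap \<open>\<rho>\<close>
  passes to the sides.  Property (V) of the norming set of sides then passes to the extreme
  points of the dual ball by splitting functionals.
\<close>

section \<open>Hahn--Banach with extreme points\<close>

text \<open>The difficulty is uniformity: a pyramid may have infinitely many sides, one for every
  functional \<open>\<phi>\<close> paired with its own \<open>\<psi>\<close>. The estimates on
  \<open>side \<phi> \<psi>\<close> are therefore arranged so that \<open>\<phi>\<close> drops out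
  of the bounds: its share is at least \<open>T \<psi> / (2 + T \<psi>)\<close>, and the value of a
  side at a foreign vertex \<open>V \<eta>\<close> is at most
  \<open>(1 + T \<eta> + M \<eta>) / 2\<close>. A second obstacle is that (IV) speaks of extreme
  points of the dual ball, while pyramids stand only over facets with interior. The bridge is that
  the minimal boundary consists of extreme points and still norms the space; the latter follows by
  tilting a point of the sphere until a single functional among the finitely many active ones wins.
  Extreme functionals themselves come from Zorn's lemma applied to sublinear functionals ordered
  pointwise.\<close>

definition sublinear :: "('a::real_vector \<Rightarrow> real) \<Rightarrow> bool" where
  "sublinear p \<longleftrightarrow> (\<forall>x y. p (x + y) \<le> p x + p y) \<and> (\<forall>c x. 0 \<le> c \<longrightarrow> p (c *\<^sub>R x) = c * p x)"

lemma sublinear_add: "sublinear p \<Longrightarrow> p (x + y) \<le> p x + p y"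
  and sublinear_scale: "sublinear p \<Longrightarrow> 0 \<le> c \<Longrightarrow> p (c *\<^sub>R x) = c * p x"
  by (auto simp: sublinear_def)

lemma sublinear_zero: "sublinear p \<Longrightarrow> p 0 = 0"
  using sublinear_scale[of p 0 0] by simp

lemma sublinear_minus: "sublinear p \<Longrightarrow> - p (- x) \<le> p x"
  using sublinear_add[of p x "- x"] sublinear_zero[of p] by simp

lemma sublinearI:
  assumes "\<And>x y. p (x + y) \<le> p x + p y"
    and pos: "\<And>c x. 0 < c \<Longrightarrow> p (c *\<^sub>R x) \<le> c * p x"
    and zero: "p 0 = 0"
  shows "sublinear p"
  unfolding sublinear_def
proof (intro conjI allI impI)
  fix c :: real and x assume "0 \<le> c"
  show "p (c *\<^sub>R x) = c * p x"
  proof (cases "c = 0")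
    case False
    with \<open>0 \<le> c\<close> have c: "0 < c" by simp
    have "p (inverse c *\<^sub>R (c *\<^sub>R x)) \<le> inverse c * p (c *\<^sub>R x)" by (rule pos) (simp add: c)
    then have "c * p x \<le> p (c *\<^sub>R x)" using c by (simp add: field_simps)
    with pos[OF c, of x] show ?thesis by simp
  qed (simp add: zero)
qed (use assms(1) in auto)

lemma sublinear_imp_linear:
  assumes "sublinear p" "\<And>x. p (- x) = - p x"
  shows "linear p"
proof (rule linearI)
  fix x y show "p (x + y) = p x + p y"
    using sublinear_add[OF assms(1), of x y] sublinear_add[OF assms(1), of "- x" "- y"]
      assms(2)[of "x + y"] assms(2)[of x] assms(2)[of y] by simp
next
  fix c x show "p (c *\<^sub>R x) = c *\<^sub>R p x"
    using sublinear_scale[OF assms(1), of c x] sublinear_scale[OF assms(1), of "- c" x]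
      assms(2)[of "c *\<^sub>R x"] by (cases "0 \<le> c") auto
qed

lemma sublinear_SUP_linear:
  assumes ne: "G \<noteq> {}" and lin: "\<And>g. g \<in> G \<Longrightarrow> linear g" and bd: "\<And>g x. g \<in> G \<Longrightarrow> g x \<le> b x"
  shows "sublinear (\<lambda>x. SUP g\<in>G. g x)"
proof -
  have bdd: "bdd_above ((\<lambda>g. g x) ` G)" for x using bd by (intro bdd_aboveI2[where M="b x"])
  show ?thesis
  proof (rule sublinearI)
    fix x y show "(SUP g\<in>G. g (x + y)) \<le> (SUP g\<in>G. g x) + (SUP g\<in>G. g y)"
      by (intro cSUP_least[OF ne])
        (auto simp: lin linear_add intro!: add_mono cSUP_upper bdd)
  next
    fix c :: real and x :: 'a assume "0 < c"
    then show "(SUP g\<in>G. g (c *\<^sub>R x)) \<le> c * (SUP g\<in>G. g x)"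
      by (intro cSUP_least[OF ne]) (auto simp: lin linear_scale intro!: cSUP_upper bdd)
  qed (use ne in \<open>simp add: lin linear_0\<close>)
qed

text \<open>For sublinear \<open>q\<close> this is the largest sublinear functional below
  \<open>q\<close> with value at most \<open>- q x\<close> at \<open>- x\<close>; the linear
  functionals below it are those below \<open>q\<close> that agree with \<open>q\<close> at
  \<open>x\<close>.\<close>

definition maximize_along :: "('a::real_vector \<Rightarrow> real) \<Rightarrow> 'a \<Rightarrow> 'a \<Rightarrow> real" where
  "maximize_along q x y = (INF t\<in>{0..}. q (y + t *\<^sub>R x) - t * q x)"

context
  fixes q :: "'a::real_vector \<Rightarrow> real" and x :: 'a
  assumes q: "sublinear q"
begin

lemma maximize_along_bdd: "bdd_below ((\<lambda>t. q (y + t *\<^sub>R x) - t * q x) ` {0..})"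
proof (rule bdd_belowI2[where m="- q (- y)"])
  fix t :: real assume "t \<in> {0..}"
  then show "- q (- y) \<le> q (y + t *\<^sub>R x) - t * q x"
    using sublinear_add[OF q, of "y + t *\<^sub>R x" "- y"] sublinear_scale[OF q, of t x] by simp
qed

lemma maximize_along_le: "0 \<le> t \<Longrightarrow> maximize_along q x y \<le> q (y + t *\<^sub>R x) - t * q x"
  unfolding maximize_along_def by (rule cINF_lower[OF maximize_along_bdd]) simp

lemma maximize_along_greatest:
  "(\<And>t. 0 \<le> t \<Longrightarrow> a \<le> q (y + t *\<^sub>R x) - t * q x) \<Longrightarrow> a \<le> maximize_along q x y"
  unfolding maximize_along_def by (rule cINF_greatest) auto

lemma maximize_along_le_self: "maximize_along q x y \<le> q y"
  using maximize_along_le[of 0 y] by simp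

lemma maximize_along_minus: "maximize_along q x (- x) \<le> - q x"
  using maximize_along_le[of 1 "- x"] sublinear_zero[OF q] by simp

lemma sublinear_maximize_along: "sublinear (maximize_along q x)"
proof (rule sublinearI)
  fix y z
  \<comment> \<open>The two infima are treated one after the other: parameters \<open>t\<close> for
    \<open>y\<close> and \<open>s\<close> for \<open>z\<close> merge into \<open>t + s\<close> for
    \<open>y + z\<close>.\<close>
  have "maximize_along q x (y + z) - (q (y + t *\<^sub>R x) - t * q x) \<le> maximize_along q x z"
    if t: "0 \<le> t" for t
  proof (rule maximize_along_greatest)
    fix s :: real assume "0 \<le> s"
    with t show "maximize_along q x (y + z) - (q (y + t *\<^sub>R x) - t * q x) \<le> q (z + s *\<^sub>R x) - s * q x"
      using maximize_along_le[of "t + s" "y + z"] sublinear_add[OF q, of "y + t *\<^sub>R x" "z + s *\<^sub>R x"]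
      by (simp add: algebra_simps)
  qed
  then have "maximize_along q x (y + z) - maximize_along q x z \<le> maximize_along q x y"
    by (intro maximize_along_greatest) (simp add: algebra_simps)
  then show "maximize_along q x (y + z) \<le> maximize_along q x y + maximize_along q x z" by simp
next
  fix c :: real and y assume c: "0 < c"
  have "maximize_along q x (c *\<^sub>R y) / c \<le> maximize_along q x y"
  proof (rule maximize_along_greatest)
    fix t :: real assume "0 \<le> t"
    then show "maximize_along q x (c *\<^sub>R y) / c \<le> q (y + t *\<^sub>R x) - t * q x"
      using maximize_along_le[of "c * t" "c *\<^sub>R y"] sublinear_scale[OF q, of c "y + t *\<^sub>R x"] c
      by (simp add: field_simps)
  qed
  then show "maximize_along q x (c *\<^sub>R y) \<le> c * maximize_along q x y"
    using c by (simp add: field_simps)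
next
  show "maximize_along q x 0 = 0"
  proof (rule antisym)
    show "maximize_along q x 0 \<le> 0" using maximize_along_le_self[of 0] sublinear_zero[OF q] by simp
    show "0 \<le> maximize_along q x 0"
      by (rule maximize_along_greatest) (simp add: sublinear_scale[OF q])
  qed
qed

end

text \<open>A face of the set of linear functionals below \<open>p\<close>, encoded by a sublinear
  majorant \<open>q\<close> instead of by a set, so that intersections along a chain become
  pointwise infima.\<close>

definition facial :: "('a::real_vector \<Rightarrow> real) \<Rightarrow> ('a \<Rightarrow> real) \<Rightarrow> bool" where
  "facial p q \<longleftrightarrow> sublinear q \<and> q \<le> p \<and>
     (\<forall>a b u. linear a \<longrightarrow> linear b \<longrightarrow> a \<le> p \<longrightarrow> b \<le> p \<longrightarrow> 0 < u \<longrightarrow> u < 1 \<longrightarrow>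
        (\<forall>y. (1 - u) * a y + u * b y \<le> q y) \<longrightarrow> a \<le> q \<and> b \<le> q)"

text \<open>Maximizers of evaluation at \<open>x\<close> over a face form a face again: a proper
  convex combination that reaches the maximum forces both members to reach it.\<close>

lemma facial_maximize_along:
  assumes "facial p q"
  shows "facial p (maximize_along q x)"
proof -
  have q: "sublinear q" and qp: "q \<le> p" using assms by (auto simp: facial_def)
  show ?thesis
    unfolding facial_def
  proof (intro conjI allI impI)
    show "sublinear (maximize_along q x)" by (rule sublinear_maximize_along[OF q])
    show "maximize_along q x \<le> p"
      using maximize_along_le_self[OF q] qp by (auto simp: le_fun_def intro: order_trans)
    fix a b :: "'a \<Rightarrow> real" and u :: real
    assume lin: "linear a" "linear b" and le: "a \<le> p" "b \<le> p" and u: "0 < u" "u < 1"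
      and c: "\<forall>y. (1 - u) * a y + u * b y \<le> maximize_along q x y"
    have "\<forall>y. (1 - u) * a y + u * b y \<le> q y"
      using c maximize_along_le_self[OF q] by (meson order_trans)
    then have ab: "a \<le> q" "b \<le> q" using assms lin le u unfolding facial_def by blast+
    have "(1 - u) * a (- x) + u * b (- x) \<le> - q x"
      using c maximize_along_minus[OF q, of x] by (meson order_trans)
    then have *: "q x \<le> (1 - u) * a x + u * b x" using lin by (simp add: linear_neg)
    have ax: "a x \<le> q x" and bx: "b x \<le> q x" using ab by (auto simp: le_fun_def)
    have "(1 - u) * (q x - a x) + u * (q x - b x) \<le> 0" using * by (simp add: algebra_simps)
    moreover have "0 \<le> (1 - u) * (q x - a x)" "0 \<le> u * (q x - b x)" using u ax bx by auto
    ultimately have "(1 - u) * (q x - a x) = 0" "u * (q x - b x) = 0" by linarith+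
    then have eq: "a x = q x" "b x = q x" using u by auto
    have "f \<le> maximize_along q x" if f: "linear f" "f \<le> q" "f x = q x" for f
    proof (rule le_funI, rule maximize_along_greatest[OF q])
      fix y and t :: real
      show "f y \<le> q (y + t *\<^sub>R x) - t * q x"
        using le_funD[OF f(2), of "y + t *\<^sub>R x"] f by (simp add: linear_add linear_scale)
    qed
    then show "a \<le> maximize_along q x" "b \<le> maximize_along q x" using ab eq lin by auto
  qed
qed

lemma facial_chain_INF:
  assumes ne: "C \<noteq> {}" and fac: "\<And>q. q \<in> C \<Longrightarrow> facial p q"
    and chain: "\<And>q q'. q \<in> C \<Longrightarrow> q' \<in> C \<Longrightarrow> q \<le> q' \<or> q' \<le> q"
  shows "facial p (\<lambda>y. INF q\<in>C. q y)" and "\<And>q y. q \<in> C \<Longrightarrow> (INF q\<in>C. q y) \<le> q y"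
proof -
  have sub: "sublinear q" and le: "q y \<le> p y" if "q \<in> C" for q y
    using fac[OF that] by (auto simp: facial_def le_fun_def)
  have bdd: "bdd_below ((\<lambda>q. q y) ` C)" for y
    using sublinear_minus[OF sub, of _ y] le[of _ "- y"]
    by (intro bdd_belowI2[where m="- p (- y)"]) (meson neg_le_iff_le order_trans)
  show lower: "(INF q\<in>C. q y) \<le> q y" if "q \<in> C" for q y
    by (rule cINF_lower[OF bdd that])
  obtain q0 where q0: "q0 \<in> C" using ne by auto
  show "facial p (\<lambda>y. INF q\<in>C. q y)"
    unfolding facial_def
  proof (intro conjI allI impI)
    show "(\<lambda>y. INF q\<in>C. q y) \<le> p"
      using lower[OF q0] le[OF q0] by (auto simp: le_fun_def intro: order_trans)
    show "sublinear (\<lambda>y. INF q\<in>C. q y)"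
    proof (rule sublinearI)
      fix y z
      \<comment> \<open>Subadditivity involves \<open>q\<close> and \<open>q'\<close> at once; the
        chain supplies one member below both.\<close>
      have pair: "(INF q\<in>C. q (y + z)) \<le> q y + q' z" if q: "q \<in> C" "q' \<in> C" for q q'
      proof -
        obtain m where m: "m \<in> C" "m \<le> q" "m \<le> q'" using chain[OF q] q by blast
        show ?thesis
          using lower[OF m(1), of "y + z"] sublinear_add[OF sub[OF m(1)], of y z]
            le_funD[OF m(2), of y] le_funD[OF m(3), of z] by linarith
      qed
      have "(INF q\<in>C. q (y + z)) - q y \<le> q' z" if "q \<in> C" "q' \<in> C" for q q'
        using pair[OF that] by simp
      then have "(INF q\<in>C. q (y + z)) - q y \<le> (INF q\<in>C. q z)" if "q \<in> C" for q
        using that by (intro cINF_greatest[OF ne]) blast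
      then have "(INF q\<in>C. q (y + z)) - (INF q\<in>C. q z) \<le> (INF q\<in>C. q y)"
        by (intro cINF_greatest[OF ne]) (simp add: algebra_simps)
      then show "(INF q\<in>C. q (y + z)) \<le> (INF q\<in>C. q y) + (INF q\<in>C. q z)" by simp
    next
      fix c :: real and y assume c: "0 < c"
      have "(INF q\<in>C. q (c *\<^sub>R y)) / c \<le> (INF q\<in>C. q y)"
      proof (rule cINF_greatest[OF ne])
        fix q assume q: "q \<in> C"
        show "(INF q\<in>C. q (c *\<^sub>R y)) / c \<le> q y"
          using lower[OF q, of "c *\<^sub>R y"] sublinear_scale[OF sub[OF q], of c y] c
          by (simp add: field_simps)
      qed
      then show "(INF q\<in>C. q (c *\<^sub>R y)) \<le> c * (INF q\<in>C. q y)" using c by (simp add: field_simps)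
    next
      show "(INF q\<in>C. q 0) = 0" using ne by (simp add: sublinear_zero[OF sub])
    qed
    fix a b :: "'a \<Rightarrow> real" and u :: real
    assume h: "linear a" "linear b" "a \<le> p" "b \<le> p" "0 < u" "u < 1"
      and c: "\<forall>y. (1 - u) * a y + u * b y \<le> (INF q\<in>C. q y)"
    have "a \<le> q \<and> b \<le> q" if q: "q \<in> C" for q
    proof -
      have "\<forall>y. (1 - u) * a y + u * b y \<le> q y" using c lower[OF q] by (meson order_trans)
      then show ?thesis using fac[OF q] h unfolding facial_def by blast
    qed
    then show "a \<le> (\<lambda>y. INF q\<in>C. q y)" "b \<le> (\<lambda>y. INF q\<in>C. q y)"
      by (auto simp: le_fun_def intro!: cINF_greatest[OF ne])
  qed
qed

lemma linear_le_linear_imp_eq: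
  assumes "linear a" "linear f" "a \<le> (f :: 'a::real_vector \<Rightarrow> real)"
  shows "a = f"
proof
  fix y show "a y = f y"
    using le_funD[OF assms(3), of y] le_funD[OF assms(3), of "- y"]
    by (simp add: linear_neg assms(1,2))
qed

text \<open>For linear \<open>f\<close>, \<open>facial p f\<close> says that \<open>f\<close> is an extreme point of the set of linear
  functionals below \<open>p\<close>; a minimal facial functional is linear.\<close>

theorem Hahn_Banach_extreme:
  assumes p: "sublinear (p :: 'a::real_vector \<Rightarrow> real)"
  obtains f where "linear f" "facial p f" "f x = p x"
proof -
  \<comment> \<open>Staying below \<open>maximize_along p x\<close> fixes the value at
    \<open>x\<close>. The order \<open>?P\<close> is reversed, so that Zorn's maximal elements are
    minimal functionals.\<close>
  let ?A = "{q. facial p q \<and> q \<le> maximize_along p x}"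
  let ?P = "\<lambda>q q' :: 'a \<Rightarrow> real. q' \<le> q"
  have pp: "facial p p" using p by (auto simp: facial_def)
  have p0: "maximize_along p x \<in> ?A" using facial_maximize_along[OF pp] by simp
  have "\<exists>m\<in>?A. \<forall>a\<in>?A. ?P m a \<longrightarrow> a = m"
  proof (rule predicate_Zorn)
    show "partial_order_on ?A (relation_of ?P ?A)"
      by (rule partial_order_on_relation_ofI) auto
    fix C assume C: "C \<in> Chains (relation_of ?P ?A)"
    then have CA: "C \<subseteq> ?A" by (auto simp: Chains_def relation_of_def)
    have ch: "q \<le> q' \<or> q' \<le> q" if "q \<in> C" "q' \<in> C" for q q'
      using C that unfolding Chains_def relation_of_def by blast
    show "\<exists>u\<in>?A. \<forall>a\<in>C. ?P a u"
    proof (cases "C = {}")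
      case False
      have fac: "\<And>q. q \<in> C \<Longrightarrow> facial p q" using CA by auto
      note I = facial_chain_INF[OF False fac ch]
      obtain q0 where "q0 \<in> C" using False by auto
      then have "(\<lambda>y. INF q\<in>C. q y) \<le> maximize_along p x"
        using I(2)[of q0] CA by (auto simp: le_fun_def intro: order_trans)
      then show ?thesis using I by (intro bexI[of _ "\<lambda>y. INF q\<in>C. q y"]) (auto simp: le_fun_def)
    qed (use p0 in auto)
  qed
  then obtain m where m: "facial p m" "m \<le> maximize_along p x"
    and min: "\<And>q. facial p q \<Longrightarrow> q \<le> m \<Longrightarrow> q = m" by (auto intro: order_trans)
  have sm: "sublinear m" and mp: "m \<le> p" using m by (auto simp: facial_def)
  have neg: "m (- y) = - m y" for y
  proof -
    \<comment> \<open>By minimality \<open>m\<close> cannot be lowered in any direction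
      \<open>y\<close>, which gives \<open>m (- y) \<le> - m y\<close>; an odd sublinear functional
      is linear.\<close>
    have "maximize_along m y = m"
      using facial_maximize_along[OF m(1)] maximize_along_le_self[OF sm]
      by (intro min) (auto simp: le_fun_def)
    then have "m (- y) \<le> - m y" using maximize_along_minus[OF sm, of y] by simp
    then show ?thesis using sublinear_minus[OF sm, of "- y"] by simp
  qed
  have lin: "linear m" by (rule sublinear_imp_linear[OF sm neg])
  have "m (- x) \<le> - p x" using le_funD[OF m(2)] maximize_along_minus[OF p] by (meson order_trans)
  then have mx: "m x = p x" using neg[of x] le_funD[OF mp, of x] by simp
  from lin m(1) mx show ?thesis by (rule that)
qed

lemma blinfun_linear: "linear (blinfun_apply f)"
  by (simp add: blinfun.bounded_linear_right bounded_linear.linear)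

lemma blinfun_of_linear_le:
  assumes lin: "linear a" and le: "a \<le> (\<lambda>y. C * norm y)" and C: "0 \<le> C"
  obtains f :: "'a::real_normed_vector \<Rightarrow>\<^sub>L real" where "blinfun_apply f = a" "norm f \<le> C"
proof -
  have ab: "\<bar>a y\<bar> \<le> C * norm y" for y
    using le_funD[OF le, of y] le_funD[OF le, of "- y"] linear_neg[OF lin, of y] by (simp add: abs_le_iff)
  have "bounded_linear a"
    using lin ab by (intro bounded_linear_intro[where K=C]) (auto simp: linear_iff mult.commute)
  then have ap: "blinfun_apply (Blinfun a) = a" by (rule bounded_linear_Blinfun_apply)
  moreover have "norm (Blinfun a) \<le> C" using ab C by (intro norm_blinfun_bound) (auto simp: ap)
  ultimately show ?thesis by (rule that)
qed

section \<open>(IV)-polyhedral norms and the minimal boundary\<close>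

text \<open>Tychonoff makes the product of the intervals compact; the linear functions form a closed
  part of it, which \<open>Blinfun\<close> maps continuously onto the dual ball.\<close>

lemma compactin_cball_weak_star: "compactin weak_star (cball (0 :: 'a::real_normed_vector \<Rightarrow>\<^sub>L real) 1)"
proof -
  define L :: "('a \<Rightarrow> real) set" where "L = {\<phi>. linear \<phi> \<and> (\<forall>y. \<bar>\<phi> y\<bar> \<le> norm y)}"
  define P :: "('a \<Rightarrow> real) set" where "P = Pi\<^sub>E UNIV (\<lambda>y. {- norm y..norm y})"
  have "compactin (product_topology (\<lambda>i::'a. euclidean :: real topology) UNIV) P"
    unfolding P_def compactin_PiE by simp
  then have P: "compact P" by (simp add: euclidean_product_topology)
  have cont [continuous_intros]: "continuous_on UNIV (\<lambda>\<phi> :: 'a \<Rightarrow> real. \<phi> y)" for y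
    by (rule continuous_on_product_then_coordinatewise) (rule continuous_on_id)
  have Leq: "L = P \<inter> ((\<Inter>y z. {\<phi>. \<phi> (y + z) = \<phi> y + \<phi> z}) \<inter> (\<Inter>c y. {\<phi>. \<phi> (c *\<^sub>R y) = c * \<phi> y}))"
    by (auto simp: L_def P_def linear_iff abs_le_iff minus_le_iff)
  have "compact L"
    unfolding Leq
    by (intro compact_Int_closed[OF P] closed_Int closed_INT ballI closed_Collect_eq continuous_intros)
  then have L: "compactin (top_of_set L) L" by (simp add: compactin_subtopology)
  have bl: "bounded_linear \<phi>" if "\<phi> \<in> L" for \<phi>
    using that by (intro bounded_linear_intro[where K=1]) (auto simp: L_def linear_iff)
  have ap: "blinfun_apply (Blinfun \<phi>) = \<phi>" if "\<phi> \<in> L" for \<phi>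
    using bl[OF that] by (rule bounded_linear_Blinfun_apply)
  have "continuous_map (top_of_set L) weak_star Blinfun"
    unfolding continuous_on_strong_operator_topo_iff_coordinatewise
  proof
    fix y
    have "continuous_on L (\<lambda>\<phi>. blinfun_apply (Blinfun \<phi>) y)"
      using continuous_on_subset[OF cont subset_UNIV, of L y] by (rule continuous_on_eq) (simp add: ap)
    then show "continuous_map (top_of_set L) euclidean (\<lambda>\<phi>. blinfun_apply (Blinfun \<phi>) y)" by simp
  qed
  from image_compactin[OF L this] have "compactin weak_star (Blinfun ` L)" .
  moreover have "Blinfun ` L = cball 0 1"
  proof (intro equalityI subsetI)
    fix f assume "f \<in> Blinfun ` L"
    then obtain \<phi> where "\<phi> \<in> L" "f = Blinfun \<phi>" by auto
    then have "norm f \<le> 1" by (intro norm_blinfun_bound) (auto simp: ap, simp add: L_def)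
    then show "f \<in> cball 0 1" by simp
  next
    fix f :: "'a \<Rightarrow>\<^sub>L real" assume f: "f \<in> cball 0 1"
    have "\<bar>f y\<bar> \<le> norm y" for y
      using norm_blinfun[of f y] f mult_right_mono[of "norm f" 1 "norm y"] by simp
    then have "blinfun_apply f \<in> L" by (simp add: L_def blinfun.bounded_linear_right bounded_linear.linear)
    then show "f \<in> Blinfun ` L" by (metis image_eqI blinfun_apply_inverse)
  qed
  ultimately show ?thesis by simp
qed

lemma dual_ball_apply_le: "f \<in> cball (0 :: 'a::real_normed_vector \<Rightarrow>\<^sub>L real) 1 \<Longrightarrow> blinfun_apply f y \<le> norm y"
  using norm_blinfun[of f y] mult_right_mono[of "norm f" 1 "norm y"] by (simp add: abs_le_iff)

lemma ext_dual_ball_norm: "ext_dual_ball norm = {f. f extreme_point_of cball 0 1}"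
  by (simp add: ext_dual_ball_def dual_ball_norm)

text \<open>For \<open>p = norm\<close>, the property \<open>facial norm \<phi>\<close> puts both
  ends of a segment through \<open>\<phi>\<close> below \<open>\<phi>\<close>, and a linear
  functional below a linear one equals it.\<close>

lemma ext_dual_ball_attains:
  obtains f :: "'a::real_normed_vector \<Rightarrow>\<^sub>L real"
  where "f \<in> ext_dual_ball norm" "blinfun_apply f x = norm x"
proof -
  have "sublinear (norm :: 'a \<Rightarrow> real)" by (auto simp: sublinear_def norm_triangle_ineq)
  then obtain \<phi> :: "'a \<Rightarrow> real" where lin\<phi>: "linear \<phi>" and fac: "facial norm \<phi>" and \<phi>x: "\<phi> x = norm x"
    by (rule Hahn_Banach_extreme)
  have \<phi>: "\<phi> \<le> norm" using fac by (simp add: facial_def)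
  obtain f where f: "blinfun_apply f = \<phi>" "norm f \<le> 1"
    using blinfun_of_linear_le[OF lin\<phi>, of 1] \<phi> by (auto simp: le_fun_def)
  have "f extreme_point_of cball 0 1"
    unfolding extreme_point_of_def
  proof (intro conjI ballI notI)
    fix a b assume ab: "a \<in> cball 0 1" "b \<in> cball 0 1" and "f \<in> open_segment a b"
    then obtain u where u: "0 < u" "u < 1" and eq: "f = (1 - u) *\<^sub>R a + u *\<^sub>R b" and ne: "a \<noteq> b"
      by (auto simp: in_segment)
    have "blinfun_apply a \<le> norm" "blinfun_apply b \<le> norm"
      using ab by (auto simp: le_fun_def dual_ball_apply_le)
    moreover have "\<forall>y. (1 - u) * a y + u * b y \<le> \<phi> y"
      unfolding f(1)[symmetric] by (simp add: eq blinfun.add_left blinfun.scaleR_left)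
    ultimately have "blinfun_apply a \<le> \<phi> \<and> blinfun_apply b \<le> \<phi>"
      using fac blinfun_linear u unfolding facial_def by blast
    then have "blinfun_apply a = \<phi> \<and> blinfun_apply b = \<phi>"
      using linear_le_linear_imp_eq[OF blinfun_linear lin\<phi>] by blast
    then show False using ne by (metis blinfun_apply_inject)
  qed (use f in simp)
  then show ?thesis using that f \<phi>x by (auto simp: ext_dual_ball_norm)
qed

text \<open>Alaoglu's theorem turns the accumulation-point condition into a finiteness statement: cover
  the dual ball by neighbourhoods containing at most one extreme point and by half-spaces
  on which evaluation at \<open>x\<close> stays away from 1.\<close>

lemma IV_polyhedral_finite_above:
  assumes IV: "IV_polyhedral (norm :: 'a::real_normed_vector \<Rightarrow> real)" and x: "norm (x :: 'a) = 1"
  obtains c where "c < 1" "finite {f \<in> ext_dual_ball norm. c < blinfun_apply f x}"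
proof -
  let ?K = "cball (0 :: 'a \<Rightarrow>\<^sub>L real) 1" and ?E = "ext_dual_ball (norm :: 'a \<Rightarrow> real)"
  define sep where "sep g U c \<longleftrightarrow> openin weak_star U \<and> g \<in> U \<and> c < 1 \<and>
    (\<forall>f\<in>U \<inter> ?E. c < blinfun_apply f x \<longrightarrow> f = g)" for g U c
  have "\<exists>U c. sep g U c" for g
  \<comment> \<open>Below 1 an open half-space serves, and the last clause of \<open>sep\<close> is
    vacuous on it. Otherwise (IV) says that \<open>g\<close> is no accumulation point, and any
    \<open>c < 1\<close> will do, here 0.\<close>
  proof (cases "g x < 1")
    case True
    let ?c = "(1 + g x) / 2"
    \<comment> \<open>The index set \<open>{()}\<close> fits a single evaluation to the indexed form
      of the basic open sets.\<close>
    have "openin weak_star {f. \<forall>i\<in>{()}. blinfun_apply f x \<in> {..<?c}}"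
      by (rule strong_operator_topology_basis) auto
    then show ?thesis using True
      unfolding sep_def by (intro exI[of _ "{f. \<forall>i\<in>{()}. blinfun_apply f x \<in> {..<?c}}"] exI[of _ ?c]) auto
  next
    case False
    then have "g \<notin> weak_star derived_set_of ?E" using IV x unfolding IV_polyhedral_def by blast
    then obtain T where "openin weak_star T" "g \<in> T" "\<forall>y\<in>?E \<inter> T. y = g"
      by (auto simp: in_derived_set_of strong_operator_topology_topspace)
    then show ?thesis unfolding sep_def by (intro exI[of _ T] exI[of _ 0]) auto
  qed
  then obtain U c where "\<And>g. sep g (U g) (c g)" by metis
  then have U: "openin weak_star (U g)" "g \<in> U g" and c: "c g < 1"
    and uniq: "f \<in> U g \<Longrightarrow> f \<in> ?E \<Longrightarrow> c g < blinfun_apply f x \<Longrightarrow> f = g" for g f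
    unfolding sep_def by (blast dest: meta_spec[of _ g])+
  have "\<exists>\<F>. finite \<F> \<and> \<F> \<subseteq> U ` ?K \<and> ?K \<subseteq> \<Union>\<F>"
    by (rule compactinD[OF compactin_cball_weak_star]) (use U in \<open>fast+\<close>)
  then obtain G where G: "finite G" "?K \<subseteq> (\<Union>g\<in>G. U g)" by (metis finite_subset_image)
  let ?c = "Max (insert 0 (c ` G))"
  have fin: "finite {f \<in> ?E. ?c < f x}"
  proof (rule finite_subset[OF _ G(1)], safe)
    fix f assume f: "f \<in> ?E" "?c < f x"
    then have "f \<in> ?K" by (simp add: ext_dual_ball_norm extreme_point_of_def)
    then obtain g where g: "g \<in> G" "f \<in> U g" using G by blast
    then have "c g \<le> ?c" using G by (intro Max_ge) auto
    then show "f \<in> G" using uniq[OF g(2) f(1)] f(2) g by simp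
  qed
  have "?c < 1" using G c by simp
  then show ?thesis using fin by (rule that)
qed

text \<open>Only finitely many extreme functionals exceed some \<open>c < 1\<close> at
  \<open>x\<close>; \<open>\<rho>\<close> is the largest among \<open>c\<close>, 0 and those of
  their values that differ from 1.\<close>

lemma IV_polyhedral_gap:
  assumes "IV_polyhedral (norm :: 'a::real_normed_vector \<Rightarrow> real)" and x: "norm (x :: 'a) = 1"
  obtains \<rho> where "0 \<le> \<rho>" "\<rho> < 1" "finite {f \<in> ext_dual_ball norm. blinfun_apply f x = 1}"
    "\<And>f. f \<in> ext_dual_ball norm \<Longrightarrow> blinfun_apply f x \<noteq> 1 \<Longrightarrow> blinfun_apply f x \<le> \<rho>"
proof -
  obtain c where c: "c < 1" and fin: "finite {f \<in> ext_dual_ball norm. c < blinfun_apply f x}"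
    using IV_polyhedral_finite_above[OF assms] .
  let ?F = "{f \<in> ext_dual_ball norm. c < blinfun_apply f x}"
  define \<rho> where "\<rho> = Max (insert 0 (insert c ((\<lambda>f. blinfun_apply f x) ` (?F - {f. blinfun_apply f x = 1}))))"
  have "blinfun_apply f x < 1" if "f \<in> ext_dual_ball norm" "blinfun_apply f x \<noteq> 1" for f
    using dual_ball_apply_le[of f x] that x by (auto simp: ext_dual_ball_norm extreme_point_of_def)
  then have "\<rho> < 1" unfolding \<rho>_def using fin c by (simp add: image_iff)
  moreover have "0 \<le> \<rho>" unfolding \<rho>_def using fin by (intro Max_ge) simp_all
  moreover have "finite {f \<in> ext_dual_ball norm. blinfun_apply f x = 1}"
    by (rule finite_subset[OF _ fin]) (use c in auto)
  moreover have "blinfun_apply f x \<le> \<rho>" if f: "f \<in> ext_dual_ball norm" "blinfun_apply f x \<noteq> 1" for f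
  proof (cases "c < blinfun_apply f x")
    case True
    have "finite ((\<lambda>f. blinfun_apply f x) ` (?F - {f. blinfun_apply f x = 1}))" using fin by simp
    then show ?thesis unfolding \<rho>_def using f True by (intro Max_ge finite.insertI insertI2 imageI) simp_all
  next
    case False
    have "c \<le> \<rho>" unfolding \<rho>_def using fin by (intro Max_ge) simp_all
    with False show ?thesis by simp
  qed
  ultimately show ?thesis using that by blast
qed

section \<open>Facets with interior and the functionals that define them\<close>

lemma face_interior_iff:
  "e \<in> face_interior f \<longleftrightarrow> blinfun_apply f e = 1 \<and>
     (\<exists>d>0. \<forall>u. blinfun_apply f u = 1 \<longrightarrow> dist u e < d \<longrightarrow> norm u \<le> 1)"
proof
  assume "e \<in> face_interior f"
  then obtain T where T: "openin (top_of_set {x. blinfun_apply f x = 1}) T" "e \<in> T" "T \<subseteq> face f"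
    by (auto simp: face_interior_def interior_of_def)
  from T(1) obtain W where "open W" "T = {x. blinfun_apply f x = 1} \<inter> W" by (auto simp: openin_open)
  with T have e: "blinfun_apply f e = 1" and "e \<in> W" and TW: "\<And>u. blinfun_apply f u = 1 \<Longrightarrow> u \<in> W \<Longrightarrow> norm u \<le> 1"
    by (auto simp: face_def)
  then obtain d where "d > 0" "\<And>u. dist u e < d \<Longrightarrow> u \<in> W" using \<open>open W\<close> by (auto simp: open_dist)
  with e TW show "blinfun_apply f e = 1 \<and> (\<exists>d>0. \<forall>u. blinfun_apply f u = 1 \<longrightarrow> dist u e < d \<longrightarrow> norm u \<le> 1)"
    by blast
next
  assume "blinfun_apply f e = 1 \<and> (\<exists>d>0. \<forall>u. blinfun_apply f u = 1 \<longrightarrow> dist u e < d \<longrightarrow> norm u \<le> 1)"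
  then obtain d where d: "blinfun_apply f e = 1" "0 < d" "\<And>u. blinfun_apply f u = 1 \<Longrightarrow> dist u e < d \<Longrightarrow> norm u \<le> 1"
    by auto
  have "openin (top_of_set {x. blinfun_apply f x = 1}) ({x. blinfun_apply f x = 1} \<inter> ball e d)" by auto
  moreover have "{x. blinfun_apply f x = 1} \<inter> ball e d \<subseteq> face f"
    using d(3) by (auto simp: face_def dist_commute)
  ultimately show "e \<in> face_interior f"
    using d(1,2) unfolding face_interior_def interior_of_def
    by (intro CollectI exI[of _ "{x. blinfun_apply f x = 1} \<inter> ball e d"]) simp
qed

text \<open>A small multiple of a kernel vector of \<open>f\<close> added to \<open>e\<close> stays
  in the region, so \<open>g\<close> vanishes on that kernel; the common value 1 at \<open>e\<close>
  fixes the scalar.\<close>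

lemma blinfun_eq_if_near_hyperplane:
  fixes f g :: "'a::real_normed_vector \<Rightarrow>\<^sub>L real"
  assumes e: "f e = 1" and d: "0 < d" and g: "\<And>u. f u = 1 \<Longrightarrow> dist u e < d \<Longrightarrow> g u = 1"
  shows "g = f"
proof (rule blinfun_eqI)
  fix y
  have ge: "g e = 1" using g[OF e] d by simp
  have ker: "g w = 0" if w: "f w = 0" for w
  proof -
    define t where "t = d / (2 * (norm w + 1))"
    have pos: "0 < 2 * (norm w + 1)" by (simp add: add_nonneg_pos)
    have t: "0 < t" unfolding t_def using d pos by simp
    have "t * (2 * (norm w + 1)) = d" unfolding t_def using pos by simp
    then have "t * norm w < d" using t d by (simp add: algebra_simps)
    then have "g (e + t *\<^sub>R w) = 1"
      using t e w by (intro g) (auto simp: blinfun.add_right blinfun.scaleR_right dist_norm)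
    then show ?thesis using ge t by (simp add: blinfun.add_right blinfun.scaleR_right)
  qed
  have "g (y - f y *\<^sub>R e) = 0" using e by (intro ker) (simp add: blinfun.diff_right blinfun.scaleR_right)
  then show "g y = f y" using ge by (simp add: blinfun.diff_right blinfun.scaleR_right)
qed

text \<open>\<open>true_face\<close> only provides some \<open>f'\<close> with the same face. That
  face contains a relatively open piece of the hyperplane of \<open>f'\<close>, so \<open>f\<close>
  and \<open>f'\<close> coincide.\<close>

lemma minimal_boundary_iff:
  "f \<in> minimal_boundary \<longleftrightarrow> norm f = 1 \<and> face_interior f \<noteq> {}"
proof
  assume f: "f \<in> minimal_boundary"
  then obtain f' where f': "face f = face f'" "face_interior f' \<noteq> {}"
    by (auto simp: minimal_boundary_def true_face_def)
  then obtain e where "e \<in> face_interior f'" by auto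
  then obtain d where d: "f' e = 1" "0 < d" "\<And>u. f' u = 1 \<Longrightarrow> dist u e < d \<Longrightarrow> norm u \<le> 1"
    by (auto simp: face_interior_iff)
  have "f = f'"
  proof (rule blinfun_eq_if_near_hyperplane[OF d(1,2)])
    fix u assume "f' u = 1" "dist u e < d"
    then have "u \<in> face f'" using d(3) by (auto simp: face_def)
    then show "f u = 1" unfolding f'(1)[symmetric] by (simp add: face_def)
  qed
  with f f' show "norm f = 1 \<and> face_interior f \<noteq> {}" by (simp add: minimal_boundary_def)
next
  assume f: "norm f = 1 \<and> face_interior f \<noteq> {}"
  have "face f \<subseteq> sphere 0 1"
  proof
    fix u assume "u \<in> face f"
    then show "u \<in> sphere 0 1"
      using dual_ball_apply_le[of f u] f by (auto simp: face_def)
  qed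
  with f show "f \<in> minimal_boundary" by (auto simp: minimal_boundary_def true_face_def)
qed

text \<open>If \<open>f\<close> is a proper convex combination of \<open>a\<close> and
  \<open>b\<close> in the dual ball, both are 1 wherever \<open>f\<close> is 1 on the unit ball,
  hence on a relatively open piece of the hyperplane, so both equal \<open>f\<close>. This carries
  the gap for extreme points over to the minimal boundary.\<close>

lemma minimal_boundary_subset_ext: "minimal_boundary \<subseteq> ext_dual_ball norm"
proof
  fix f :: "'a \<Rightarrow>\<^sub>L real" assume "f \<in> minimal_boundary"
  then obtain e where nf: "norm f = 1" and "e \<in> face_interior f" by (auto simp: minimal_boundary_iff)
  then obtain d where d: "f e = 1" "0 < d" "\<And>u. f u = 1 \<Longrightarrow> dist u e < d \<Longrightarrow> norm u \<le> 1"
    by (auto simp: face_interior_iff)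
  have "f extreme_point_of cball 0 1"
    unfolding extreme_point_of_def
  proof (intro conjI ballI notI)
    fix a b assume ab: "a \<in> cball 0 1" "b \<in> cball 0 1" and "f \<in> open_segment a b"
    then obtain t where t: "0 < t" "t < 1" and eq: "f = (1 - t) *\<^sub>R a + t *\<^sub>R b" and ne: "a \<noteq> b"
      by (auto simp: in_segment)
    have "a u = 1 \<and> b u = 1" if u: "f u = 1" "dist u e < d" for u
    proof -
      have le: "a u \<le> 1" "b u \<le> 1"
        using dual_ball_apply_le[OF ab(1), of u] dual_ball_apply_le[OF ab(2), of u] d(3)[OF u] by auto
      have "f u = (1 - t) * a u + t * b u" by (simp add: eq blinfun.add_left blinfun.scaleR_left)
      then have "(1 - t) * (1 - a u) + t * (1 - b u) = 0" using u(1) by (simp add: algebra_simps)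
      moreover have "0 \<le> (1 - t) * (1 - a u)" "0 \<le> t * (1 - b u)" using t le by auto
      ultimately have "(1 - t) * (1 - a u) = 0" "t * (1 - b u) = 0" by linarith+
      then show ?thesis using t by auto
    qed
    then have "a = f" "b = f" by (auto intro!: blinfun_eq_if_near_hyperplane[OF d(1,2)])
    then show False using ne by simp
  qed (use nf in simp)
  then show "f \<in> ext_dual_ball norm" by (simp add: ext_dual_ball_norm)
qed

text \<open>Finitely many kernels, being proper subspaces, do not cover the space: the induction
  tilts the old vector by a multiple of \<open>w\<close> outside finitely many bad values.\<close>

lemma ex_nonzero_direction:
  fixes D :: "('a::real_normed_vector \<Rightarrow>\<^sub>L real) set"
  assumes "finite D" "0 \<notin> D"
  shows "\<exists>v. \<forall>d\<in>D. blinfun_apply d v \<noteq> 0"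
  using assms
proof (induction D rule: finite_induct)
  case (insert d D)
  then obtain v where v: "\<forall>d\<in>D. blinfun_apply d v \<noteq> 0" by auto
  obtain w where w: "blinfun_apply d w \<noteq> 0" using insert.prems by (metis blinfun_eqI insertI1 zero_blinfun.rep_eq)
  show ?case
  proof (cases "blinfun_apply d v = 0")
    case True
    have "finite ((\<lambda>f. - (blinfun_apply f v / blinfun_apply f w)) ` insert d D \<union> {0})" using insert by auto
    then obtain t :: real where t: "t \<notin> (\<lambda>f. - (blinfun_apply f v / blinfun_apply f w)) ` insert d D \<union> {0}"
      using ex_new_if_finite infinite_UNIV_char_0 by blast
    have "f (v + t *\<^sub>R w) \<noteq> 0" if "f \<in> insert d D" for f
    proof
      assume "f (v + t *\<^sub>R w) = 0"
      then have z: "f v + t * f w = 0" by (simp add: blinfun.add_right blinfun.scaleR_right)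
      show False
      proof (cases "f w = 0")
        case fw: True
        with z v w that show False by auto
      next
        case False
        then have "t = - (f v / f w)" using z by (simp add: field_simps)
        with t that show False by blast
      qed
    qed
    then show ?thesis by blast
  next
    case False
    with v show ?thesis by auto
  qed
qed simp

text \<open>The point \<open>x\<close> is tilted in a direction \<open>v\<close> separating the
  finitely many extreme functionals active there. The one with the largest value at \<open>v\<close>
  then beats all other extreme functionals by a margin at the tilted point, hence also near it, so
  its face has interior.\<close>

lemma minimal_boundary_attains:
  assumes IV: "IV_polyhedral (norm :: 'a::real_normed_vector \<Rightarrow> real)" and x: "norm (x :: 'a) = 1"
  obtains f where "f \<in> minimal_boundary" "blinfun_apply f x = 1"
proof -
  let ?E = "ext_dual_ball (norm :: 'a \<Rightarrow> real)"
  have ball: "f \<in> cball 0 1" if "f \<in> ?E" for f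
    using that by (simp add: ext_dual_ball_norm extreme_point_of_def)
  obtain \<rho> where \<rho>: "0 \<le> \<rho>" "\<rho> < 1" and fin: "finite {f \<in> ?E. f x = 1}"
    and gap: "\<And>f. f \<in> ?E \<Longrightarrow> f x \<noteq> 1 \<Longrightarrow> f x \<le> \<rho>"
    using IV_polyhedral_gap[OF IV x] by blast
  define F where "F = {f \<in> ?E. f x = 1}"
  have Fne: "F \<noteq> {}" using ext_dual_ball_attains[of x] x by (auto simp: F_def)
  have finF: "finite F" using fin by (simp add: F_def)
  obtain v where v: "\<And>f g. f \<in> F \<Longrightarrow> g \<in> F \<Longrightarrow> f \<noteq> g \<Longrightarrow> f v \<noteq> g v"
  proof -
    have "\<exists>v. \<forall>d\<in>(\<lambda>(f, g). f - g) ` (F \<times> F) - {0}. blinfun_apply d v \<noteq> 0"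
      by (rule ex_nonzero_direction) (use finF in auto)
    then obtain v where v: "\<And>f g. f \<in> F \<Longrightarrow> g \<in> F \<Longrightarrow> f - g \<noteq> 0 \<Longrightarrow> (f - g) v \<noteq> 0"
      by blast
    show ?thesis by (rule that[of v]) (use v in \<open>fastforce simp: blinfun.diff_left\<close>)
  qed
  obtain f0 where f0: "f0 \<in> F" and max: "\<And>f. f \<in> F \<Longrightarrow> f v \<le> f0 v"
  proof -
    have "Max ((\<lambda>f. blinfun_apply f v) ` F) \<in> (\<lambda>f. blinfun_apply f v) ` F"
      using finF Fne by (intro Max_in) auto
    then obtain f0 where "f0 \<in> F" "f0 v = Max ((\<lambda>f. blinfun_apply f v) ` F)" by force
    then show ?thesis using finF by (intro that[of f0]) auto
  qed
  have f0E: "f0 \<in> ?E" and f0x: "f0 x = 1" using f0 by (auto simp: F_def)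
  \<comment> \<open>Each functional changes by less than \<open>(1 - \<rho>) / 4\<close> under the
    tilt, so those inactive at \<open>x\<close> stay below \<open>f0\<close> by more than
    \<open>(1 - \<rho>) / 2\<close>.\<close>
  define t where "t = (1 - \<rho>) / (4 * (norm v + 1))"
  have npos: "0 < 4 * (norm v + 1)" by (simp add: add_nonneg_pos)
  have t: "0 < t" unfolding t_def using \<rho> npos by simp
  have "t * (4 * (norm v + 1)) = 1 - \<rho>" unfolding t_def using npos by simp
  then have tv: "4 * (t * norm v) < 1 - \<rho>" using t by (simp add: algebra_simps)
  define y where "y = x + t *\<^sub>R v"
  have fy: "f y = f x + t * f v" for f :: "'a \<Rightarrow>\<^sub>L real"
    by (simp add: y_def blinfun.add_right blinfun.scaleR_right)
  have fv: "\<bar>f v\<bar> \<le> norm v" if "f \<in> ?E" for f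
    using dual_ball_apply_le[OF ball[OF that], of v] dual_ball_apply_le[OF ball[OF that], of "- v"]
    by (simp add: abs_le_iff blinfun.minus_right)
  have tfv: "\<bar>t * f v\<bar> \<le> t * norm v" if "f \<in> ?E" for f
    using fv[OF that] t by (simp add: abs_mult)
  \<comment> \<open>Twice the margin: the entry \<open>1 - \<rho>\<close> accounts for the inactive
    functionals, the others for the active ones.\<close>
  define m where "m = Min (insert (1 - \<rho>) ((\<lambda>f. 2 * t * (blinfun_apply f0 v - blinfun_apply f v)) ` (F - {f0})))"
  have "f v < f0 v" if "f \<in> F" "f \<noteq> f0" for f
    using max[OF that(1)] v[OF f0 that(1)] that(2) by simp
  then have mpos: "0 < m"
    unfolding m_def using finF \<rho> t by (subst Min_gr_iff) auto
  have mle: "2 * f y \<le> 2 * f0 y - m" if f: "f \<in> ?E" "f \<noteq> f0" for f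
  proof (cases "f x = 1")
    case True
    with f have "m \<le> 2 * t * (f0 v - f v)" unfolding m_def F_def[symmetric]
      using finF by (intro Min_le) (auto simp: F_def)
    then show ?thesis using True f0x by (simp add: fy algebra_simps)
  next
    case False
    have "m \<le> 1 - \<rho>" unfolding m_def using finF by (intro Min_le) auto
    then show ?thesis
      using gap[OF f(1) False] tfv[OF f(1)] tfv[OF f0E] tv f0x by (simp add: fy)
  qed
  have ny: "norm y = f0 y"
  proof -
    obtain g where "g \<in> ?E" "g y = norm y" by (rule ext_dual_ball_attains)
    with mle[of g] mpos dual_ball_apply_le[OF ball[OF f0E], of y] show ?thesis by fastforce
  qed
  have f0y: "0 < f0 y" using tfv[OF f0E] tv \<rho> f0x fy[of f0] by (simp add: abs_le_iff)
  define e where "e = (1 / f0 y) *\<^sub>R y"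
  have f0e: "f0 e = 1" using f0y by (simp add: e_def blinfun.scaleR_right)
  \<comment> \<open>The margin \<open>m / 2\<close> at \<open>y\<close>, rescaled to
    \<open>e\<close>; moving by less than this cannot lift another extreme functional to 1.\<close>
  let ?d = "m / (2 * f0 y)"
  have "norm u \<le> 1" if u: "f0 u = 1" "dist u e < ?d" for u
  proof -
    obtain g where g: "g \<in> ?E" "g u = norm u" by (rule ext_dual_ball_attains)
    show ?thesis
    proof (cases "g = f0")
      case False
      have "2 * g y \<le> 2 * f0 y - m" by (rule mle[OF g(1) False])
      then have "g e \<le> 1 - ?d" using f0y by (simp add: e_def blinfun.scaleR_right field_simps)
      moreover have "g u - g e \<le> dist u e"
        using dual_ball_apply_le[OF ball[OF g(1)], of "u - e"] by (simp add: dist_norm blinfun.diff_right)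
      ultimately show ?thesis using g u by simp
    qed (use g u in simp)
  qed
  moreover have "0 < ?d" using mpos f0y by simp
  ultimately have "e \<in> face_interior f0" using f0e unfolding face_interior_iff by blast
  moreover have "norm f0 = 1"
  proof (rule antisym)
    show "norm f0 \<le> 1" using ball[OF f0E] by simp
    show "1 \<le> norm f0" using norm_blinfun[of f0 x] f0x x by simp
  qed
  ultimately have "f0 \<in> minimal_boundary" by (auto simp: minimal_boundary_iff)
  then show ?thesis using f0x by (rule that)
qed

section \<open>(V)-polyhedrality from a norming set\<close>

text \<open>The two demands on \<open>h\<close> force \<open>h z \<le> p (z + w) + q w - f w\<close>
  for all \<open>w\<close>, and \<open>S\<close> is the infimum of these bounds. Conversely
  \<open>w = 0\<close> returns \<open>h \<le> p\<close>, and evaluation at \<open>- z\<close> with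
  \<open>w = z\<close> returns \<open>f - h \<le> q\<close>.\<close>

lemma sandwich_sum_sublinear:
  fixes p q f :: "'a::real_vector \<Rightarrow> real"
  assumes p: "sublinear p" and q: "sublinear q" and f: "linear f" and le: "\<And>z. f z \<le> p z + q z"
  obtains h where "linear h" "h \<le> p" "\<And>z. f z - h z \<le> q z"
proof -
  define S where "S z = (INF w. p (z + w) + q w - f w)" for z
  have bdd: "bdd_below (range (\<lambda>w. p (z + w) + q w - f w))" for z
  proof (rule bdd_belowI2[where m="- p (- z)"])
    fix w show "- p (- z) \<le> p (z + w) + q w - f w"
      using sublinear_add[OF p, of "z + w" "- z"] le[of w] by simp
  qed
  have lower: "S z \<le> p (z + w) + q w - f w" for z w
    unfolding S_def by (rule cINF_lower[OF bdd]) simp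
  have greatest: "a \<le> S z" if "\<And>w. a \<le> p (z + w) + q w - f w" for a z
    unfolding S_def by (rule cINF_greatest) (use that in auto)
  have "sublinear S"
  proof (rule sublinearI)
    fix y z
    have "S (y + z) - (p (y + v) + q v - f v) \<le> S z" for v
    proof (rule greatest)
      fix w
      show "S (y + z) - (p (y + v) + q v - f v) \<le> p (z + w) + q w - f w"
        using lower[of "y + z" "v + w"] sublinear_add[OF p, of "y + v" "z + w"]
          sublinear_add[OF q, of v w] linear_add[OF f, of v w] by (simp add: algebra_simps)
    qed
    then have "S (y + z) - S z \<le> S y" by (intro greatest) (simp add: algebra_simps)
    then show "S (y + z) \<le> S y + S z" by simp
  next
    fix c :: real and z assume c: "0 < c"
    have "S (c *\<^sub>R z) / c \<le> S z"
    proof (rule greatest)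
      fix w
      have "S (c *\<^sub>R z) \<le> c * (p (z + w) + q w - f w)"
        using lower[of "c *\<^sub>R z" "c *\<^sub>R w"] sublinear_scale[OF p, of c "z + w"]
          sublinear_scale[OF q, of c w] linear_scale[OF f, of c w] c
        by (simp add: algebra_simps)
      then show "S (c *\<^sub>R z) / c \<le> p (z + w) + q w - f w" using c by (simp add: field_simps)
    qed
    then show "S (c *\<^sub>R z) \<le> c * S z" using c by (simp add: field_simps)
  next
    show "S 0 = 0"
    proof (rule antisym)
      show "S 0 \<le> 0" using lower[of 0 0] sublinear_zero[OF p] sublinear_zero[OF q] linear_0[OF f] by simp
      show "0 \<le> S 0" by (rule greatest) (use le in simp)
    qed
  qed
  then obtain h where h: "linear h" "facial S h" by (rule Hahn_Banach_extreme)
  then have hS: "h z \<le> S z" for z by (auto simp: facial_def le_fun_def)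
  have "h z \<le> p z" for z
    using hS[of z] lower[of z 0] sublinear_zero[OF q] linear_0[OF f] by simp
  moreover have "f z - h z \<le> q z" for z
    using hS[of "- z"] lower[of "- z" z] sublinear_zero[OF p] linear_neg[OF h(1), of z] by simp
  ultimately show ?thesis using h(1) by (intro that[of h]) (auto simp: le_fun_def)
qed

text \<open>A minimax argument in the plane: the pairs dominating some
  \<open>(p z - f z, q z - f z)\<close> form a convex set disjoint from the open negative quadrant,
  and the normalised normal of a separating line gives the weights.\<close>

lemma convex_combination_below_max:
  fixes p q f :: "'a::real_vector \<Rightarrow> real"
  assumes p: "sublinear p" and q: "sublinear q" and f: "linear f" and le: "\<And>z. f z \<le> max (p z) (q z)"
  obtains a where "0 \<le> a" "a \<le> 1" "\<And>z. f z \<le> (1 - a) * p z + a * q z"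
proof -
  let ?S = "{(s, t). \<exists>z. p z - f z \<le> s \<and> q z - f z \<le> t}"
  let ?T = "{(s, t). s < 0 \<and> t < 0} :: (real \<times> real) set"
  have "?S \<inter> ?T = {}"
  proof (rule equals0I, clarsimp)
    fix s t z assume "p z - f z \<le> s" "q z - f z \<le> t" "s < 0" "t < 0"
    then show False using le[of z] by linarith
  qed
  moreover have "convex ?T"
  proof -
    have "?T = {..<0} \<times> {..<0}" by auto
    then show ?thesis by (simp only: convex_Times convex_real_interval)
  qed
  moreover have "convex ?S"
  proof (rule convexI, clarsimp)
    fix s t s' t' u v z z'
    assume h: "p z - f z \<le> s" "q z - f z \<le> t" "p z' - f z' \<le> s'" "q z' - f z' \<le> t'"
      and uv: "(0::real) \<le> u" "0 \<le> v" "u + v = 1"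
    have comb: "r (u *\<^sub>R z + v *\<^sub>R z') - f (u *\<^sub>R z + v *\<^sub>R z') \<le> u * (r z - f z) + v * (r z' - f z')"
      if "sublinear r" for r
      using sublinear_add[OF that, of "u *\<^sub>R z" "v *\<^sub>R z'"] sublinear_scale[OF that, of u z]
        sublinear_scale[OF that, of v z'] linear_add[OF f, of "u *\<^sub>R z" "v *\<^sub>R z'"] uv
      by (simp add: linear_scale[OF f] algebra_simps)
    have "u * (p z - f z) + v * (p z' - f z') \<le> u * s + v * s'"
      "u * (q z - f z) + v * (q z' - f z') \<le> u * t + v * t'"
      using h uv by (auto intro!: add_mono mult_left_mono)
    then show "\<exists>z. p z - f z \<le> u * s + v * s' \<and> q z - f z \<le> u * t + v * t'"
      using comb[OF p] comb[OF q] by (meson order_trans)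
  qed
  moreover have "(p 0 - f 0, q 0 - f 0) \<in> ?S" "(- 1, - 1) \<in> ?T" by blast simp
  then have "?S \<noteq> {}" "?T \<noteq> {}" by blast+
  ultimately obtain w b where w: "w \<noteq> 0" "\<And>y. y \<in> ?T \<Longrightarrow> w \<bullet> y \<le> b" "\<And>y. y \<in> ?S \<Longrightarrow> b \<le> w \<bullet> y"
    using separating_hyperplane_sets[of ?T ?S] unfolding Int_commute[of ?T ?S] by blast
  obtain \<alpha> \<beta> where [simp]: "w = (\<alpha>, \<beta>)" by (cases w)
  have T: "\<alpha> * s + \<beta> * t \<le> b" if "s < 0" "t < 0" for s t using w(2)[of "(s, t)"] that by simp
  have S: "b \<le> \<alpha> * s + \<beta> * t" if "p z - f z \<le> s" "q z - f z \<le> t" for s t z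
  proof -
    have "(s, t) \<in> ?S" using that by blast
    from w(3)[OF this] show ?thesis by simp
  qed
  \<comment> \<open>The quadrant comes arbitrarily near the origin; \<open>n\<close> is so small
    that \<open>(- n, - n)\<close> costs at most \<open>e\<close>.\<close>
  have b: "0 \<le> b"
  proof (rule field_le_epsilon)
    fix e :: real assume e: "0 < e"
    define n where "n = e / (\<bar>\<alpha>\<bar> + \<bar>\<beta>\<bar> + 1)"
    have n: "0 < n" using e by (simp add: n_def add_nonneg_pos)
    have "n * (\<bar>\<alpha>\<bar> + \<bar>\<beta>\<bar> + 1) = e" by (simp add: n_def)
    moreover have "\<alpha> * n \<le> \<bar>\<alpha>\<bar> * n" "\<beta> * n \<le> \<bar>\<beta>\<bar> * n" using n by (auto intro: mult_right_mono)
    moreover have "n * (\<bar>\<alpha>\<bar> + \<bar>\<beta>\<bar> + 1) = \<bar>\<alpha>\<bar> * n + \<bar>\<beta>\<bar> * n + n" by (simp add: algebra_simps)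
    ultimately have "\<alpha> * n + \<beta> * n \<le> e" using n by linarith
    with T[of "- n" "- n"] n show "0 \<le> b + e" by simp
  qed
  have pf: "p 0 - f 0 = 0" "q 0 - f 0 = 0"
    using sublinear_zero[OF p] sublinear_zero[OF q] linear_0[OF f] by auto
  \<comment> \<open>\<open>?S\<close> is closed upwards, so it contains \<open>(1, 0)\<close> and
    \<open>(0, 1)\<close>.\<close>
  have nn: "0 \<le> \<alpha>" "0 \<le> \<beta>" using S[of 0 1 0] S[of 0 0 1] b pf by auto
  then have pos: "0 < \<alpha> + \<beta>" using w(1) by (cases "\<alpha> = 0") (auto simp: zero_prod_def add_nonneg_pos add_pos_nonneg)
  show ?thesis
  proof (rule that[of "\<beta> / (\<alpha> + \<beta>)"])
    fix z
    have "0 \<le> \<alpha> * (p z - f z) + \<beta> * (q z - f z)" using S[OF order_refl order_refl, of z] b by linarith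
    then have "(\<alpha> + \<beta>) * f z \<le> \<alpha> * p z + \<beta> * q z" by (simp add: algebra_simps)
    then have "f z \<le> (\<alpha> * p z + \<beta> * q z) / (\<alpha> + \<beta>)" using pos by (simp add: field_simps)
    also have "\<dots> = \<alpha> / (\<alpha> + \<beta>) * p z + \<beta> / (\<alpha> + \<beta>) * q z"
      by (simp add: add_divide_distrib)
    also have "\<alpha> / (\<alpha> + \<beta>) = 1 - \<beta> / (\<alpha> + \<beta>)" using pos by (simp add: field_simps)
    finally show "f z \<le> (1 - \<beta> / (\<alpha> + \<beta>)) * p z + \<beta> / (\<alpha> + \<beta>) * q z" .
  qed (use nn pos in \<open>auto simp: field_simps\<close>)
qed

lemma linear_divide: "linear g \<Longrightarrow> linear (\<lambda>z. g z / a :: real)"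
  by (simp add: linear_iff add_divide_distrib)

section \<open>Dual norm and duality sets of an equivalent norm\<close>

context
  fixes N :: "'a::real_normed_vector \<Rightarrow> real"
  assumes N: "equivalent_norm N"
begin

lemma equivalent_norm_zero: "N x = 0 \<longleftrightarrow> x = 0"
  and equivalent_norm_scale: "N (c *\<^sub>R x) = \<bar>c\<bar> * N x"
  and equivalent_norm_triangle: "N (x + y) \<le> N x + N y"
  using N by (auto simp: equivalent_norm_def is_norm_def)

lemma equivalent_norm_minus: "N (- x) = N x"
  using equivalent_norm_scale[of "-1" x] by simp

lemma equivalent_norm_nonneg: "0 \<le> N x"
  using equivalent_norm_triangle[of x "- x"] equivalent_norm_minus[of x] equivalent_norm_zero[of 0] by simp

text \<open>Equivalence with \<open>norm\<close> bounds the set under the real-valued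
  \<open>SUP\<close>, as the rules for it require; symmetry of \<open>N\<close> then replaces the
  absolute value by a one-sided inequality.\<close>

lemma dual_norm_le_one_iff: "dual_norm N f \<le> 1 \<longleftrightarrow> (\<forall>y. blinfun_apply f y \<le> N y)"
proof -
  obtain c where c: "0 < c" "\<And>x. c * norm x \<le> N x" using N by (auto simp: equivalent_norm_def)
  have "\<bar>f x\<bar> \<le> norm f / c" if "N x \<le> 1" for x
  proof -
    have "norm x \<le> 1 / c" using c(2)[of x] that c(1) by (simp add: field_simps)
    then have "norm f * norm x \<le> norm f * (1 / c)" by (intro mult_left_mono) auto
    then show ?thesis using norm_blinfun[of f x] by simp
  qed
  then have bdd: "bdd_above ((\<lambda>x. \<bar>f x\<bar>) ` {x. N x \<le> 1})" by (intro bdd_aboveI2) auto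
  have ne: "{x. N x \<le> 1} \<noteq> {}" using equivalent_norm_zero[of 0] by (auto intro: exI[of _ 0])
  have "dual_norm N f \<le> 1 \<longleftrightarrow> (\<forall>x. N x \<le> 1 \<longrightarrow> \<bar>f x\<bar> \<le> 1)"
    unfolding dual_norm_def using cSUP_le_iff[OF ne bdd] by simp
  also have "\<dots> \<longleftrightarrow> (\<forall>y. f y \<le> N y)"
  proof safe
    fix y assume h: "\<forall>x. N x \<le> 1 \<longrightarrow> \<bar>f x\<bar> \<le> 1"
    show "f y \<le> N y"
    proof (cases "y = 0")
      case False
      then have Ny: "0 < N y" using equivalent_norm_zero[of y] equivalent_norm_nonneg[of y] by simp
      then have "N ((1 / N y) *\<^sub>R y) = 1" by (simp add: equivalent_norm_scale)
      then have "\<bar>f ((1 / N y) *\<^sub>R y)\<bar> \<le> 1" using h by simp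
      then show ?thesis using Ny by (simp add: blinfun.scaleR_right field_simps abs_le_iff)
    qed (simp add: equivalent_norm_nonneg)
  next
    fix x assume h: "\<forall>y. f y \<le> N y" and "N x \<le> 1"
    then show "\<bar>f x\<bar> \<le> 1"
      using h[rule_format, of x] h[rule_format, of "- x"]
      unfolding equivalent_norm_minus blinfun.minus_right abs_le_iff by linarith
  qed
  finally show ?thesis .
qed

lemma duality_set_iff:
  assumes "N x = 1"
  shows "f \<in> duality_set N x \<longleftrightarrow> (\<forall>y. blinfun_apply f y \<le> N y) \<and> blinfun_apply f x = 1"
proof -
  have "dual_norm N f = 1" if f: "\<forall>y. f y \<le> N y" "f x = 1"
  proof (rule antisym)
    show "dual_norm N f \<le> 1" using f by (simp add: dual_norm_le_one_iff)
    show "1 \<le> dual_norm N f"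
    proof (rule ccontr)
      assume "\<not> 1 \<le> dual_norm N f"
      then have lt: "dual_norm N f < 1" by simp
      have "\<bar>f y\<bar> \<le> 1" if "N y \<le> 1" for y
        using f(1)[rule_format, of y] f(1)[rule_format, of "- y"] that
        by (simp add: equivalent_norm_minus blinfun.minus_right abs_le_iff)
      then have "bdd_above ((\<lambda>x. \<bar>f x\<bar>) ` {x. N x \<le> 1})" by (intro bdd_aboveI2) auto
      then have "\<bar>f x\<bar> \<le> dual_norm N f"
        unfolding dual_norm_def by (rule cSUP_upper2[of _ _ x]) (use assms in auto)
      then show False using lt f by simp
    qed
  qed
  then show ?thesis by (auto simp: duality_set_def dual_norm_le_one_iff[symmetric])
qed

end

lemma property_VI:
  assumes "\<And>x. N x = 1 \<Longrightarrow> \<exists>c<1. \<forall>f\<in>\<A> - duality_set N x. blinfun_apply f x \<le> c"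
  shows "property_V N \<A>"
  unfolding property_V_def
proof (intro allI impI)
  fix x assume "N x = 1"
  then obtain c where c: "c < 1" "\<forall>f\<in>\<A> - duality_set N x. blinfun_apply f x \<le> c" using assms by blast
  have "(SUP f \<in> \<A> - duality_set N x. ereal (blinfun_apply f x)) \<le> ereal c"
    by (intro SUP_least) (use c in simp)
  also have "\<dots> < 1" using c by (simp add: one_ereal_def)
  finally show "(SUP f \<in> \<A> - duality_set N x. ereal (blinfun_apply f x)) < 1" .
qed

text \<open>Near a point \<open>x\<close> of the unit sphere the functionals of \<open>G\<close> split into those attaining 1 at
  \<open>x\<close> and those at most \<open>c\<close> there.  With \<open>p\<close>, \<open>q\<close> the suprema over the two parts, any
  functional below \<open>N = max p q\<close> is a convex combination of one below \<open>p\<close> and one below \<open>q\<close>;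
  an extreme one is therefore below \<open>p\<close>, and attains 1 at \<open>x\<close>, or below \<open>q\<close>.\<close>

lemma V_polyhedral_if_norming_gap:
  fixes N :: "'a::real_normed_vector \<Rightarrow> real" and G :: "('a \<Rightarrow>\<^sub>L real) set"
  assumes N: "equivalent_norm N" and Gne: "G \<noteq> {}" and Gle: "\<And>g y. g \<in> G \<Longrightarrow> blinfun_apply g y \<le> N y"
    and Gsup: "\<And>y. N y = (SUP g\<in>G. blinfun_apply g y)"
    and Gminus: "\<And>g. g \<in> G \<Longrightarrow> - g \<in> G"
    and gap: "\<And>x. N x = 1 \<Longrightarrow> \<exists>c<1. \<forall>g\<in>G. blinfun_apply g x = 1 \<or> blinfun_apply g x \<le> c"
  shows "V_polyhedral N"
  unfolding V_polyhedral_def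
proof (rule property_VI)
  fix x assume x: "N x = 1"
  obtain c where c: "c < 1" and cG: "\<And>g. g \<in> G \<Longrightarrow> blinfun_apply g x = 1 \<or> blinfun_apply g x \<le> c"
    using gap[OF x] by auto
  define D where "D = {g \<in> G. blinfun_apply g x = 1}"
  define Q where "Q = {g \<in> G. blinfun_apply g x \<noteq> 1}"
  have Dne: "D \<noteq> {}"
  proof
    assume "D = {}"
    then have "blinfun_apply g x \<le> c" if "g \<in> G" for g using cG[OF that] that by (auto simp: D_def)
    then have "N x \<le> c" unfolding Gsup using Gne by (intro cSUP_least)
    then show False using x c by simp
  qed
  then obtain g0 where g0: "g0 \<in> D" by auto
  then have "- g0 \<in> Q" using Gminus by (auto simp: D_def Q_def blinfun.minus_left)
  then have Qne: "Q \<noteq> {}" by auto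
  define p where "p y = (SUP g\<in>D. blinfun_apply g y)" for y
  define q where "q y = (SUP g\<in>Q. blinfun_apply g y)" for y
  have bdd: "bdd_above ((\<lambda>g. blinfun_apply g y) ` F)" if "F \<subseteq> G" for F y
    by (rule bdd_aboveI2[where M="N y"]) (use Gle that in auto)
  have DG: "D \<subseteq> G" and QG: "Q \<subseteq> G" by (auto simp: D_def Q_def)
  have sub: "sublinear (\<lambda>y. SUP g\<in>F. blinfun_apply g y)" if "F \<noteq> {}" "F \<subseteq> G" for F
    using sublinear_SUP_linear[of "blinfun_apply ` F" N] that Gle blinfun_linear
    by (auto simp: image_image)
  have p: "sublinear p" and q: "sublinear q"
    using sub[OF Dne DG] sub[OF Qne QG] by (simp_all add: p_def[abs_def] q_def[abs_def])
  have pN: "p y \<le> N y" and qN: "q y \<le> N y" for y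
    unfolding p_def q_def using Dne Qne DG QG Gle by (auto intro!: cSUP_least)
  have Nmax: "N y \<le> max (p y) (q y)" for y
  proof -
    have "blinfun_apply g y \<le> max (p y) (q y)" if "g \<in> G" for g
    proof (cases "g \<in> D")
      case True
      then have "blinfun_apply g y \<le> p y" unfolding p_def by (intro cSUP_upper bdd[OF DG])
      then show ?thesis by simp
    next
      case False
      then have "blinfun_apply g y \<le> q y" unfolding q_def using that
        by (intro cSUP_upper bdd[OF QG]) (auto simp: D_def Q_def)
      then show ?thesis by simp
    qed
    then show ?thesis unfolding Gsup[of y] using Gne by (intro cSUP_least)
  qed
  have qx: "q x \<le> c" unfolding q_def using Qne cG by (intro cSUP_least) (auto simp: Q_def)
  \<comment> \<open>All members of \<open>D\<close> are 1 at \<open>x\<close>, so \<open>p\<close>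
    is pinched there: a linear functional below \<open>p\<close> must take the value 1 at
    \<open>x\<close>.\<close>
  have px: "p x \<le> 1" "p (- x) \<le> - 1"
    unfolding p_def using Dne by (auto intro!: cSUP_least simp: D_def blinfun.minus_right)
  obtain C where C: "0 < C" "\<And>y. N y \<le> C * norm y" using N by (auto simp: equivalent_norm_def)
  show "\<exists>c<1. \<forall>f\<in>ext_dual_ball N - duality_set N x. blinfun_apply f x \<le> c"
  proof (intro exI[of _ c] conjI ballI)
    fix f assume "f \<in> ext_dual_ball N - duality_set N x"
    then have fext: "f extreme_point_of dual_ball N" and fD: "f \<notin> duality_set N x"
      by (auto simp: ext_dual_ball_def)
    then have fN: "f y \<le> N y" for y
      by (auto simp: extreme_point_of_def dual_ball_def dual_norm_le_one_iff[OF N])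
    have "f z \<le> max (p z) (q z)" for z using order_trans[OF fN Nmax] .
    then obtain a where a: "0 \<le> a" "a \<le> 1" "\<And>z. f z \<le> (1 - a) * p z + a * q z"
      by (rule convex_combination_below_max[OF p q blinfun_linear]) blast
    \<comment> \<open>For \<open>a\<close> strictly between 0 and 1, \<open>f\<close> is a convex
      combination of \<open>f2\<close> below \<open>p\<close> and \<open>f1\<close> below
      \<open>q\<close>; extremeness makes both equal to \<open>f\<close>.\<close>
    have "(\<forall>y. f y \<le> p y) \<or> (\<forall>y. f y \<le> q y)"
    proof (cases "a = 0 \<or> a = 1")
      case True
      then show ?thesis using a(3) by auto
    next
      case False
      then have a01: "0 < a" "a < 1" using a by auto
      have "sublinear (\<lambda>z. (1 - a) * p z)" "sublinear (\<lambda>z. a * q z)"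
        using p q a01 mult_left_mono[of "p _" _ "1 - a"] mult_left_mono[of "q _" _ a]
        by (auto simp: sublinear_def distrib_left[symmetric])
      from sandwich_sum_sublinear[OF this blinfun_linear a(3)]
      obtain h where h: "linear h" "h \<le> (\<lambda>z. (1 - a) * p z)" "\<And>z. f z - h z \<le> a * q z"
        by blast
      have hp: "h z / (1 - a) \<le> p z" for z using le_funD[OF h(2), of z] a01 by (simp add: field_simps)
      have hq: "(f z - h z) / a \<le> q z" for z using h(3)[of z] a01 by (simp add: field_simps)
      have CN: "s \<le> C * norm z" if "s \<le> N z" for s z using that C(2)[of z] by simp
      obtain f2 :: "'a \<Rightarrow>\<^sub>L real" where f2: "blinfun_apply f2 = (\<lambda>z. h z / (1 - a))"
      proof (rule blinfun_of_linear_le[of "\<lambda>z. h z / (1 - a)" C])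
        show "linear (\<lambda>z. h z / (1 - a))"
          by (rule linear_divide[OF h(1)])
        show "(\<lambda>z. h z / (1 - a)) \<le> (\<lambda>y. C * norm y)"
          by (rule le_funI, rule CN, rule order_trans[OF hp pN])
      qed (use C that in auto)
      obtain f1 :: "'a \<Rightarrow>\<^sub>L real" where f1: "blinfun_apply f1 = (\<lambda>z. (f z - h z) / a)"
      proof (rule blinfun_of_linear_le[of "\<lambda>z. (f z - h z) / a" C])
        show "linear (\<lambda>z. (f z - h z) / a)"
          by (rule linear_divide[OF linear_compose_sub[OF blinfun_linear h(1)]])
        show "(\<lambda>z. (f z - h z) / a) \<le> (\<lambda>y. C * norm y)"
          by (rule le_funI, rule CN, rule order_trans[OF hq qN])
      qed (use C that in auto)
      have eq: "f = (1 - a) *\<^sub>R f2 + a *\<^sub>R f1"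
        by (rule blinfun_eqI) (use a01 in \<open>simp add: blinfun.add_left blinfun.scaleR_left f1 f2\<close>)
      have "f1 \<in> dual_ball N" "f2 \<in> dual_ball N"
        unfolding dual_ball_def mem_Collect_eq dual_norm_le_one_iff[OF N] f1 f2
        using hp hq pN qN by (meson order_trans)+
      then have "f \<notin> open_segment f2 f1" using fext by (auto simp: extreme_point_of_def)
      then have "f2 = f1" using eq a01 unfolding in_segment by blast
      with eq have "f = (1 - a) *\<^sub>R f1 + a *\<^sub>R f1" by metis
      also have "\<dots> = f1" by (rule scaleR_collapse)
      finally have ff: "f = f1" .
      have "\<forall>y. f1 y \<le> q y" unfolding f1 using hq by blast
      then have "\<forall>y. f y \<le> q y" by (subst ff)
      then show ?thesis ..
    qed
    then show "blinfun_apply f x \<le> c"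
    proof
      assume "\<forall>y. f y \<le> q y"
      then show ?thesis using qx by (meson order_trans)
    next
      assume fp: "\<forall>y. f y \<le> p y"
      have "f x = 1"
        using fp[rule_format, of x] fp[rule_format, of "- x"] px by (simp add: blinfun.minus_right)
      then have "f \<in> duality_set N x" using fN by (simp add: duality_set_iff[OF N x])
      then show ?thesis using fD by simp
    qed
  qed (rule c)
qed

lemma is_banach_norm_if_equivalent:
  fixes N :: "'a::banach \<Rightarrow> real"
  assumes N: "equivalent_norm N"
  shows "is_banach_norm N"
proof -
  obtain c C where c: "0 < c" "\<And>x. c * norm x \<le> N x" and C: "0 < C" "\<And>x. N x \<le> C * norm x"
    using N unfolding equivalent_norm_def by blast
  interpret M: Metric_space UNIV "\<lambda>x y. N (x - y)"
  proof (rule Metric_space.intro)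
    fix x y z
    show "N (x - y) = N (y - x)" using equivalent_norm_minus[OF N, of "x - y"] by simp
    show "N (x - z) \<le> N (x - y) + N (y - z)" using equivalent_norm_triangle[OF N, of "x - y" "y - z"] by simp
  qed (simp_all add: equivalent_norm_nonneg[OF N] equivalent_norm_zero[OF N])
  have "M.mcomplete"
    unfolding M.mcomplete_def
  proof (intro allI impI)
    fix s assume s: "M.MCauchy s"
    have "Cauchy s"
    proof (rule metric_CauchyI)
      fix e :: real assume "0 < e"
      then have "0 < c * e" using c by simp
      then obtain n where n: "\<And>i j. n \<le> i \<Longrightarrow> n \<le> j \<Longrightarrow> N (s i - s j) < c * e"
        using s unfolding M.MCauchy_def by blast
      have "dist (s i) (s j) < e" if "n \<le> i" "n \<le> j" for i j
      proof -
        have "c * norm (s i - s j) < c * e" using n[OF that] c(2)[of "s i - s j"] by simp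
        then show ?thesis using c(1) by (simp add: dist_norm)
      qed
      then show "\<exists>M. \<forall>m\<ge>M. \<forall>n\<ge>M. dist (s m) (s n) < e" by blast
    qed
    then obtain l where l: "s \<longlonglongrightarrow> l" using Cauchy_convergent convergent_def by blast
    have "limitin M.mtopology s l sequentially"
      unfolding M.limitin_metric
    proof (intro conjI allI impI)
      fix e :: real assume "0 < e"
      then have "\<forall>\<^sub>F n in sequentially. dist (s n) l < e / C"
        using l C(1) by (intro tendstoD) auto
      then show "\<forall>\<^sub>F n in sequentially. s n \<in> UNIV \<and> N (s n - l) < e"
      proof eventually_elim
        case (elim n)
        then have "C * norm (s n - l) < e" using C(1) by (simp add: dist_norm field_simps)
        then show ?case using C(2)[of "s n - l"] by simp
      qed
    qed simp
    then show "\<exists>x. limitin M.mtopology s x sequentially" by blast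
  qed
  then show ?thesis using N unfolding is_banach_norm_def equivalent_norm_def by blast
qed

section \<open>Pyramids over facets\<close>

text \<open>Facets are indexed by the functionals themselves instead of by ordinals with signs, so
  \<open>V\<close> is odd and \<open>T\<close> even. \<open>V \<psi>\<close> is the apex over the
  facet of \<open>\<psi>\<close>, \<open>T \<psi>\<close> its height, and \<open>M \<psi>\<close>
  bounds the other functionals there. For \<open>M = (1 + \<tau>) * \<mu>\<close>, the condition
  \<open>M_less\<close> reads \<open>\<tau> + \<mu> + \<tau> * \<mu> < 1\<close>.\<close>

locale facet_vertices =
  fixes \<B> :: "('a::real_normed_vector \<Rightarrow>\<^sub>L real) set" and V :: "('a \<Rightarrow>\<^sub>L real) \<Rightarrow> 'a"
    and T M :: "('a \<Rightarrow>\<^sub>L real) \<Rightarrow> real" and K :: "'a set" and R :: real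
  assumes nonempty: "\<B> \<noteq> {}"
    and minus: "\<psi> \<in> \<B> \<Longrightarrow> - \<psi> \<in> \<B>"
    and V_minus: "\<psi> \<in> \<B> \<Longrightarrow> V (- \<psi>) = - V \<psi>"
    and T_minus: "\<psi> \<in> \<B> \<Longrightarrow> T (- \<psi>) = T \<psi>"
    and le_norm: "\<psi> \<in> \<B> \<Longrightarrow> blinfun_apply \<psi> y \<le> norm y"
    and attains: "norm y = 1 \<Longrightarrow> \<exists>\<psi>\<in>\<B>. blinfun_apply \<psi> y = 1"
    and finite_attaining: "norm y = 1 \<Longrightarrow> finite {\<psi> \<in> \<B>. blinfun_apply \<psi> y = 1}"
    and gap: "norm y = 1 \<Longrightarrow> \<exists>\<rho><1. \<forall>\<psi>\<in>\<B>. blinfun_apply \<psi> y = 1 \<or> blinfun_apply \<psi> y \<le> \<rho>"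
    and T_pos: "\<psi> \<in> \<B> \<Longrightarrow> 0 < T \<psi>"
    and V_own: "\<psi> \<in> \<B> \<Longrightarrow> blinfun_apply \<psi> (V \<psi>) = 1 + T \<psi>"
    and V_other: "\<psi> \<in> \<B> \<Longrightarrow> \<phi> \<in> \<B> \<Longrightarrow> \<phi> \<noteq> \<psi> \<Longrightarrow> \<phi> \<noteq> - \<psi> \<Longrightarrow> \<bar>blinfun_apply \<phi> (V \<psi>)\<bar> \<le> M \<psi>"
    and M_less: "\<psi> \<in> \<B> \<Longrightarrow> M \<psi> < 1 - T \<psi>"
    and ex_other: "\<psi> \<in> \<B> \<Longrightarrow> \<exists>\<phi>\<in>\<B>. \<phi> \<noteq> \<psi> \<and> \<phi> \<noteq> - \<psi>"
    and K_def: "K = closure (convex hull (V ` \<B>))"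
    and ball_subset: "cball 0 1 \<subseteq> K"
    and subset_ball: "K \<subseteq> cball 0 R"
    and R_pos: "0 < R"
begin

text \<open>The solution \<open>c\<close> of
  \<open>(1 - c) * \<phi> (V \<psi>) + c * (1 + T \<psi>) = 1\<close>, an explicit form of the
  coefficient described in \<open>combination_at\<close>.\<close>

definition weight :: "('a \<Rightarrow>\<^sub>L real) \<Rightarrow> ('a \<Rightarrow>\<^sub>L real) \<Rightarrow> real" where
  "weight \<phi> \<psi> = (1 - blinfun_apply \<phi> (V \<psi>)) / (1 + T \<psi> - blinfun_apply \<phi> (V \<psi>))"

definition side :: "('a \<Rightarrow>\<^sub>L real) \<Rightarrow> ('a \<Rightarrow>\<^sub>L real) \<Rightarrow> ('a \<Rightarrow>\<^sub>L real)" where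
  "side \<phi> \<psi> = (1 - weight \<phi> \<psi>) *\<^sub>R \<phi> + weight \<phi> \<psi> *\<^sub>R \<psi>"

definition sides :: "('a \<Rightarrow>\<^sub>L real) set" where
  "sides = {side \<phi> \<psi> | \<phi> \<psi>. \<phi> \<in> \<B> \<and> \<psi> \<in> \<B> \<and> \<phi> \<noteq> \<psi> \<and> \<phi> \<noteq> - \<psi>}"

lemma side_apply: "blinfun_apply (side \<phi> \<psi>) y = (1 - weight \<phi> \<psi>) * \<phi> y + weight \<phi> \<psi> * \<psi> y"
  by (simp add: side_def blinfun.add_left blinfun.scaleR_left)

lemma sidesE:
  assumes "g \<in> sides"
  obtains \<phi> \<psi> where "g = side \<phi> \<psi>" "\<phi> \<in> \<B>" "\<psi> \<in> \<B>" "\<phi> \<noteq> \<psi>" "\<phi> \<noteq> - \<psi>"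
  using assms by (auto simp: sides_def)

lemma sidesI: "\<phi> \<in> \<B> \<Longrightarrow> \<psi> \<in> \<B> \<Longrightarrow> \<phi> \<noteq> \<psi> \<Longrightarrow> \<phi> \<noteq> - \<psi> \<Longrightarrow> side \<phi> \<psi> \<in> sides"
  by (auto simp: sides_def)

lemma sides_nonempty: "sides \<noteq> {}"
  using nonempty ex_other sidesI by (metis all_not_in_conv)

context
  fixes \<phi> \<psi> assumes mem: "\<phi> \<in> \<B>" "\<psi> \<in> \<B>" and ne: "\<phi> \<noteq> \<psi>" "\<phi> \<noteq> - \<psi>"
begin

lemma vertex_bounds: "\<phi> (V \<psi>) < 1 - T \<psi>" "- 1 < \<phi> (V \<psi>)"
  using V_other[OF mem(2,1) ne] M_less[OF mem(2)] T_pos[OF mem(2)] by auto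

lemma one_minus_weight: "1 - weight \<phi> \<psi> = T \<psi> / (1 + T \<psi> - \<phi> (V \<psi>))"
  using vertex_bounds T_pos[OF mem(2)] by (simp add: weight_def field_simps)

text \<open>With \<open>d = 1 - \<phi> (V \<psi>)\<close> the weight is
  \<open>d / (d + T \<psi>)\<close>, and \<open>M_less\<close> gives
  \<open>d > T \<psi>\<close>.\<close>

lemma weight_gt_half: "1 / 2 < weight \<phi> \<psi>"
  using vertex_bounds T_pos[OF mem(2)] by (simp add: weight_def field_simps)

text \<open>The denominator \<open>1 + T \<psi> - \<phi> (V \<psi>)\<close> stays below
  \<open>2 + T \<psi>\<close> whatever \<open>\<phi>\<close> is; this makes the gap uniform over all
  sides of one pyramid.\<close>

lemma one_minus_weight_ge: "T \<psi> / (2 + T \<psi>) \<le> 1 - weight \<phi> \<psi>"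
  unfolding one_minus_weight using vertex_bounds T_pos[OF mem(2)]
  by (intro divide_left_mono mult_pos_pos) auto

lemma weight_less_one: "weight \<phi> \<psi> < 1"
proof -
  have "0 < 1 - weight \<phi> \<psi>"
    unfolding one_minus_weight using vertex_bounds T_pos[OF mem(2)] by (intro divide_pos_pos) auto
  then show ?thesis by simp
qed

lemma weight_unique:
  assumes "(1 - c) * \<phi> (V \<psi>) + c * \<psi> (V \<psi>) = 1"
  shows "c = weight \<phi> \<psi>"
proof -
  have "c * (1 + T \<psi> - \<phi> (V \<psi>)) = 1 - \<phi> (V \<psi>)"
    using assms V_own[OF mem(2)] by (simp add: algebra_simps)
  moreover have "1 + T \<psi> - \<phi> (V \<psi>) \<noteq> 0" using vertex_bounds T_pos[OF mem(2)] by simp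
  ultimately show ?thesis by (simp add: weight_def field_simps)
qed

lemma side_own_vertex: "side \<phi> \<psi> (V \<psi>) = 1"
proof -
  have nz: "1 + T \<psi> - \<phi> (V \<psi>) \<noteq> 0" using vertex_bounds T_pos[OF mem(2)] by simp
  have "side \<phi> \<psi> (V \<psi>) = \<phi> (V \<psi>) + weight \<phi> \<psi> * (1 + T \<psi> - \<phi> (V \<psi>))"
    unfolding side_apply V_own[OF mem(2)] by (simp add: algebra_simps)
  also have "weight \<phi> \<psi> * (1 + T \<psi> - \<phi> (V \<psi>)) = 1 - \<phi> (V \<psi>)"
    using nz by (simp add: weight_def)
  finally show ?thesis by simp
qed

lemma combination_at_eq_side: "combination_at \<phi> \<psi> (V \<psi>) = side \<phi> \<psi>"
proof -
  have ap: "((1 - c) *\<^sub>R \<phi> + c *\<^sub>R \<psi>) (V \<psi>) = (1 - c) * \<phi> (V \<psi>) + c * \<psi> (V \<psi>)" for c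
    by (simp add: blinfun.add_left blinfun.scaleR_left)
  have "(THE c. 0 < c \<and> c < 1 \<and> ((1 - c) *\<^sub>R \<phi> + c *\<^sub>R \<psi>) (V \<psi>) = 1) = weight \<phi> \<psi>"
  proof (rule the_equality)
    show "0 < weight \<phi> \<psi> \<and> weight \<phi> \<psi> < 1 \<and>
        ((1 - weight \<phi> \<psi>) *\<^sub>R \<phi> + weight \<phi> \<psi> *\<^sub>R \<psi>) (V \<psi>) = 1"
      using weight_gt_half weight_less_one side_own_vertex unfolding side_def by auto
  qed (auto simp: ap intro: weight_unique)
  then show ?thesis by (simp add: combination_at_def side_def Let_def)
qed

lemma minus_side: "- side \<phi> \<psi> = side (- \<phi>) (- \<psi>)"
proof -
  have "weight (- \<phi>) (- \<psi>) = weight \<phi> \<psi>"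
    by (simp add: weight_def V_minus[OF mem(2)] T_minus[OF mem(2)] blinfun.minus_left blinfun.minus_right)
  then show ?thesis by (simp add: side_def)
qed

lemma side_le_norm: "side \<phi> \<psi> y \<le> norm y"
proof -
  have "side \<phi> \<psi> y \<le> (1 - weight \<phi> \<psi>) * norm y + weight \<phi> \<psi> * norm y"
    unfolding side_apply using weight_gt_half weight_less_one le_norm mem
    by (intro add_mono mult_left_mono) auto
  then show ?thesis by (simp add: algebra_simps)
qed

text \<open>More than half of the weight lies on \<open>\<psi>\<close>, which is at most
  \<open>M \<eta>\<close> at \<open>V \<eta>\<close>, while \<open>\<phi>\<close>, possibly
  \<open>\<eta>\<close> itself, is at most \<open>1 + T \<eta>\<close> there.\<close>

lemma side_other_vertex:
  assumes \<eta>: "\<eta> \<in> \<B>" "\<eta> \<noteq> \<psi>" "\<eta> \<noteq> - \<psi>"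
  shows "side \<phi> \<psi> (V \<eta>) \<le> (1 + T \<eta> + M \<eta>) / 2"
proof -
  let ?w = "weight \<phi> \<psi>"
  have \<psi>\<eta>: "\<psi> \<noteq> - \<eta>" using \<eta>(3) by auto
  have M: "\<psi> (V \<eta>) \<le> M \<eta>" "0 \<le> M \<eta>"
    using V_other[OF \<eta>(1) mem(2)] \<eta>(2) \<psi>\<eta> by auto
  have "\<phi> (V \<eta>) \<le> 1 + T \<eta>"
  proof (cases "\<phi> = \<eta> \<or> \<phi> = - \<eta>")
    case True
    then show ?thesis using V_own[OF \<eta>(1)] T_pos[OF \<eta>(1)] by (auto simp: blinfun.minus_left)
  next
    case False
    then show ?thesis using V_other[OF \<eta>(1) mem(1)] M_less[OF \<eta>(1)] T_pos[OF \<eta>(1)] by auto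
  qed
  then have "side \<phi> \<psi> (V \<eta>) \<le> (1 - ?w) * (1 + T \<eta>) + ?w * M \<eta>"
    unfolding side_apply using M weight_gt_half weight_less_one
    by (intro add_mono mult_left_mono) auto
  also have "\<dots> = (1 + T \<eta> + M \<eta>) / 2 - (?w - 1 / 2) * (1 + T \<eta> - M \<eta>)"
    by (simp add: field_simps)
  also have "\<dots> \<le> (1 + T \<eta> + M \<eta>) / 2"
  proof -
    have "0 \<le> (?w - 1 / 2) * (1 + T \<eta> - M \<eta>)"
      using weight_gt_half M_less[OF \<eta>(1)] T_pos[OF \<eta>(1)] by (intro mult_nonneg_nonneg) auto
    then show ?thesis by linarith
  qed
  finally show ?thesis .
qed

end

lemma vertex_bound_less_one: "\<psi> \<in> \<B> \<Longrightarrow> (1 + T \<psi> + M \<psi>) / 2 < 1"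
  using M_less[of \<psi>] by simp

lemma minus_sides: "g \<in> sides \<Longrightarrow> - g \<in> sides"
  by (elim sidesE) (auto simp: minus_side intro!: sidesI minus)

lemma sides_le_norm: "g \<in> sides \<Longrightarrow> blinfun_apply g y \<le> norm y"
  by (elim sidesE) (auto simp: side_le_norm)

lemma sides_le_one:
  assumes g: "g \<in> sides" and y: "y \<in> K"
  shows "blinfun_apply g y \<le> 1"
proof -
  obtain \<phi> \<psi> where *: "g = side \<phi> \<psi>" "\<phi> \<in> \<B>" "\<psi> \<in> \<B>" "\<phi> \<noteq> \<psi>" "\<phi> \<noteq> - \<psi>" using sidesE[OF g] .
  have "g (V \<eta>) \<le> 1" if \<eta>: "\<eta> \<in> \<B>" for \<eta>
  proof -
    consider "\<eta> = \<psi>" | "\<eta> = - \<psi>" | "\<eta> \<noteq> \<psi>" "\<eta> \<noteq> - \<psi>" by blast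
    then show ?thesis
    proof cases
      case 3
      then show ?thesis
        using side_other_vertex[OF *(2-5) \<eta>] vertex_bound_less_one[OF \<eta>] * by simp
    qed (use * in \<open>auto simp: side_own_vertex V_minus blinfun.minus_right\<close>)
  qed
  then have "V ` \<B> \<subseteq> {y. g y \<le> 1}" by auto
  moreover have "convex {y. g y \<le> 1}"
    using convex_linear_vimage[OF blinfun_linear[of g], of "{..1}"] by (simp add: vimage_def)
  moreover have "closed {y. g y \<le> 1}"
    by (intro closed_Collect_le continuous_intros linear_continuous_on blinfun.bounded_linear_right)
  ultimately have "K \<subseteq> {y. g y \<le> 1}" unfolding K_def by (intro closure_minimal hull_minimal)
  with y show ?thesis by auto
qed

lemma attains_norm: "y \<noteq> 0 \<Longrightarrow> \<exists>\<psi>\<in>\<B>. blinfun_apply \<psi> y = norm y"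
  using attains[of "(1 / norm y) *\<^sub>R y"] by (auto simp: blinfun.scaleR_right field_simps)

text \<open>A point outside the original ball that is cut off by no side lies in the pyramid over a
  single facet: project it from the apex \<open>V \<psi>\<close> onto the hyperplane \<open>\<psi> = 1\<close>.\<close>

lemma in_pyramid:
  assumes le: "\<And>g. g \<in> sides \<Longrightarrow> blinfun_apply g x \<le> 1" and x: "1 < norm x"
  obtains \<psi> s y where "\<psi> \<in> \<B>" "0 \<le> s" "s < 1" "x = (1 - s) *\<^sub>R V \<psi> + s *\<^sub>R y" "norm y \<le> 1"
    "s \<noteq> 0 \<Longrightarrow> blinfun_apply \<psi> y = 1"
proof -
  obtain \<psi> where \<psi>: "\<psi> \<in> \<B>" "\<psi> x = norm x" using attains_norm[of x] x by force
  have side: "side \<eta> \<psi> (x - V \<psi>) \<le> 0" if "\<eta> \<in> \<B>" "\<eta> \<noteq> \<psi>" "\<eta> \<noteq> - \<psi>" for \<eta>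
    using le[OF sidesI[OF that(1) \<psi>(1) that(2,3)]] side_own_vertex[OF that(1) \<psi>(1) that(2,3)]
    by (simp add: blinfun.diff_right)
  show ?thesis
  proof (cases "\<psi> x < 1 + T \<psi>")
    case True
    \<comment> \<open>The ray from the apex through \<open>x\<close> meets \<open>\<psi> = 1\<close>
      at parameter \<open>t\<close>, and \<open>t > 1\<close> because \<open>1 < \<psi> x\<close>.
      The side inequalities persist along the ray, and on \<open>\<psi> = 1\<close> they say
      \<open>\<eta> y \<le> 1\<close>.\<close>
    define t where "t = T \<psi> / (1 + T \<psi> - \<psi> x)"
    have t1: "1 < t" using True x \<psi>(2) unfolding t_def by (simp add: field_simps)
    define y where "y = V \<psi> + t *\<^sub>R (x - V \<psi>)"
    have ay: "f y = f (V \<psi>) + t * f (x - V \<psi>)" for f :: "'a \<Rightarrow>\<^sub>L real"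
      by (simp add: y_def blinfun.add_right blinfun.scaleR_right)
    have "t * (1 + T \<psi> - \<psi> x) = T \<psi>" using True by (simp add: t_def)
    then have \<psi>y: "\<psi> y = 1" using V_own[OF \<psi>(1)] by (simp add: ay blinfun.diff_right algebra_simps)
    have "\<eta> y \<le> 1" if \<eta>: "\<eta> \<in> \<B>" for \<eta>
    proof -
      consider "\<eta> = \<psi>" | "\<eta> = - \<psi>" | "\<eta> \<noteq> \<psi>" "\<eta> \<noteq> - \<psi>" by blast
      then show ?thesis
      proof cases
        case 3
        note c = \<eta> \<psi>(1) 3
        have "t * side \<eta> \<psi> (x - V \<psi>) \<le> 0" using side[OF \<eta> 3] t1 by (simp add: mult_nonneg_nonpos)
        then have "side \<eta> \<psi> y \<le> 1" using side_own_vertex[OF c] by (simp add: ay)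
        then have "(1 - weight \<eta> \<psi>) * \<eta> y \<le> (1 - weight \<eta> \<psi>) * 1" using \<psi>y by (simp add: side_apply)
        then show ?thesis using weight_less_one[OF c] by simp
      qed (use \<psi>y in \<open>auto simp: blinfun.minus_left\<close>)
    qed
    then have ny: "norm y \<le> 1" using attains_norm[of y] by (cases "y = 0") force+
    have "x = (1 - 1 / t) *\<^sub>R V \<psi> + (1 / t) *\<^sub>R y"
      using t1 by (simp add: y_def algebra_simps)
    then show ?thesis using \<psi>(1) t1 ny \<psi>y by (intro that[of \<psi> "1 / t" y]) auto
  next
    case False
    \<comment> \<open>At or above the height of the apex, the sides for \<open>\<eta>\<close> and
      \<open>- \<eta>\<close> make both functionals nonpositive at \<open>x - V \<psi>\<close>,
      which leaves only \<open>x = V \<psi>\<close>.\<close>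
    then have d: "0 \<le> \<psi> (x - V \<psi>)" using V_own[OF \<psi>(1)] by (simp add: blinfun.diff_right)
    have key: "(1 - weight \<eta> \<psi>) * \<eta> (x - V \<psi>) \<le> - (weight \<eta> \<psi> * \<psi> (x - V \<psi>))"
      if "\<eta> \<in> \<B>" "\<eta> \<noteq> \<psi>" "\<eta> \<noteq> - \<psi>" for \<eta>
      using side[OF that] by (simp add: side_apply)
    have le0: "\<eta> (x - V \<psi>) \<le> 0" and lt0: "0 < \<psi> (x - V \<psi>) \<Longrightarrow> \<eta> (x - V \<psi>) < 0"
      if \<eta>: "\<eta> \<in> \<B>" "\<eta> \<noteq> \<psi>" "\<eta> \<noteq> - \<psi>" for \<eta>
    proof -
      note c = \<eta>(1) \<psi>(1) \<eta>(2,3)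
      have w: "0 < weight \<eta> \<psi>" "0 < 1 - weight \<eta> \<psi>"
        using weight_gt_half[OF c] weight_less_one[OF c] by auto
      have "0 \<le> weight \<eta> \<psi> * \<psi> (x - V \<psi>)" using w d by simp
      then have "(1 - weight \<eta> \<psi>) * \<eta> (x - V \<psi>) \<le> 0" using key[OF \<eta>] by simp
      then show "\<eta> (x - V \<psi>) \<le> 0" using w by (simp add: mult_le_0_iff)
      assume "0 < \<psi> (x - V \<psi>)"
      then have "0 < weight \<eta> \<psi> * \<psi> (x - V \<psi>)" using w by simp
      then have "(1 - weight \<eta> \<psi>) * \<eta> (x - V \<psi>) < 0" using key[OF \<eta>] by simp
      then show "\<eta> (x - V \<psi>) < 0" using w by (simp add: mult_less_0_iff)
    qed
    have neg: "- \<eta> \<in> \<B>" "- \<eta> \<noteq> \<psi>" "- \<eta> \<noteq> - \<psi>" if "\<eta> \<in> \<B>" "\<eta> \<noteq> \<psi>" "\<eta> \<noteq> - \<psi>" for \<eta>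
      using that minus by auto
    obtain \<eta> where \<eta>: "\<eta> \<in> \<B>" "\<eta> \<noteq> \<psi>" "\<eta> \<noteq> - \<psi>" using ex_other[OF \<psi>(1)] by blast
    have \<psi>0: "\<psi> (x - V \<psi>) = 0"
    proof (rule ccontr)
      assume "\<psi> (x - V \<psi>) \<noteq> 0"
      then have "0 < \<psi> (x - V \<psi>)" using d by simp
      from lt0[OF \<eta> this] lt0[OF neg[OF \<eta>] this] show False by (simp add: blinfun.minus_left)
    qed
    have "x - V \<psi> = 0"
    proof (rule ccontr)
      assume nz: "x - V \<psi> \<noteq> 0"
      then obtain \<phi> where \<phi>: "\<phi> \<in> \<B>" "\<phi> (x - V \<psi>) = norm (x - V \<psi>)" using attains_norm by blast
      then have "\<phi> (x - V \<psi>) \<le> 0"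
        using le0[of \<phi>] \<psi>0 by (cases "\<phi> = \<psi> \<or> \<phi> = - \<psi>") (auto simp: blinfun.minus_left)
      with \<phi> nz show False by simp
    qed
    \<comment> \<open>At the apex \<open>s = 0\<close> and \<open>y = 0\<close> is a dummy; hence
      the last conclusion is conditional on \<open>s \<noteq> 0\<close>.\<close>
    then show ?thesis using \<psi>(1) by (intro that[of \<psi> 0 0]) auto
  qed
qed

lemma convex_K: "convex K"
  by (simp add: K_def convex_closure)

lemma V_in_K: "\<psi> \<in> \<B> \<Longrightarrow> V \<psi> \<in> K"
  unfolding K_def using closure_subset hull_subset by (metis image_eqI subsetD)

text \<open>A point cut off by no side lies in the unit ball or in a pyramid, both inside
  \<open>K\<close>. This identifies the gauge of \<open>K\<close> with the supremum of the
  sides.\<close>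

lemma K_iff: "y \<in> K \<longleftrightarrow> (\<forall>g\<in>sides. blinfun_apply g y \<le> 1)"
proof
  assume le: "\<forall>g\<in>sides. blinfun_apply g y \<le> 1"
  show "y \<in> K"
  proof (cases "norm y \<le> 1")
    case True
    then show ?thesis using ball_subset by auto
  next
    case False
    then obtain \<psi> s u where "\<psi> \<in> \<B>" "0 \<le> s" "s < 1" "y = (1 - s) *\<^sub>R V \<psi> + s *\<^sub>R u" "norm u \<le> 1"
      using in_pyramid[of y] le by (metis not_le)
    moreover from this have "u \<in> K" using ball_subset by auto
    ultimately show ?thesis
      using convexD[OF convex_K V_in_K, of \<psi> u "1 - s" s] by simp
  qed
qed (use sides_le_one in blast)

lemma sides_gap:
  assumes le: "\<And>g. g \<in> sides \<Longrightarrow> blinfun_apply g x \<le> 1" and x: "1 \<le> norm x"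
  shows "\<exists>c<1. \<forall>g\<in>sides. blinfun_apply g x = 1 \<or> blinfun_apply g x \<le> c"
proof (cases "norm x = 1")
  case True
  obtain \<rho> where \<rho>: "\<rho> < 1" "\<And>\<psi>. \<psi> \<in> \<B> \<Longrightarrow> \<psi> x = 1 \<or> \<psi> x \<le> \<rho>" using gap[OF True] by blast
  let ?F = "{\<psi> \<in> \<B>. \<psi> x = 1}"
  \<comment> \<open>\<open>?k \<psi>\<close> bounds the sides with \<open>\<psi>\<close> active at
    \<open>x\<close> and \<open>\<phi>\<close> not; \<open>(1 + \<rho>) / 2\<close> bounds all sides
    with inactive \<open>\<psi>\<close>, as \<open>\<psi>\<close> carries more than half of the
    weight.\<close>
  let ?k = "\<lambda>\<psi>. 1 - T \<psi> / (2 + T \<psi>) * (1 - \<rho>)"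
  have fin: "finite (insert ((1 + \<rho>) / 2) (?k ` ?F))" using finite_attaining[OF True] by simp
  define c where "c = Max (insert ((1 + \<rho>) / 2) (?k ` ?F))"
  have "?k \<psi> < 1" if "\<psi> \<in> \<B>" for \<psi>
    using T_pos[OF that] \<rho> by simp
  then have "c < 1" unfolding c_def using fin \<rho> by (subst Max_less_iff) auto
  moreover have "g x = 1 \<or> g x \<le> c" if g: "g \<in> sides" for g
  proof -
    obtain \<phi> \<psi> where g_eq: "g = side \<phi> \<psi>" and p: "\<phi> \<in> \<B>" "\<psi> \<in> \<B>" "\<phi> \<noteq> \<psi>" "\<phi> \<noteq> - \<psi>"
      using sidesE[OF g] .
    let ?w = "weight \<phi> \<psi>"
    have w: "1 / 2 < ?w" "?w < 1" using weight_gt_half[OF p] weight_less_one[OF p] by auto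
    have gx: "g x = (1 - ?w) * \<phi> x + ?w * \<psi> x" by (simp add: g_eq side_apply)
    show ?thesis
    proof (cases "\<psi> x = 1")
      case \<psi>1: True
      show ?thesis
      proof (cases "\<phi> x = 1")
        case False
        then have "\<phi> x \<le> \<rho>" using \<rho>(2)[OF p(1)] by simp
        then have "g x \<le> (1 - ?w) * \<rho> + ?w" unfolding gx \<psi>1 using w by simp
        also have "\<dots> = 1 - (1 - ?w) * (1 - \<rho>)" by (simp add: algebra_simps)
        also have "\<dots> \<le> ?k \<psi>"
          using mult_right_mono[OF one_minus_weight_ge[OF p], of "1 - \<rho>"] \<rho>(1) by simp
        also have "\<dots> \<le> c" unfolding c_def using fin p \<psi>1 by (intro Max_ge) auto
        finally show ?thesis ..
      qed (simp add: gx \<psi>1)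
    next
      case False
      then have "\<psi> x \<le> \<rho>" using \<rho>(2)[OF p(2)] by simp
      moreover have "\<phi> x \<le> 1" using le_norm[OF p(1), of x] True by simp
      ultimately have "g x \<le> (1 - ?w) * 1 + ?w * \<rho>"
        unfolding gx using w by (intro add_mono mult_left_mono) auto
      also have "\<dots> = (1 + \<rho>) / 2 - (?w - 1 / 2) * (1 - \<rho>)" by (simp add: field_simps)
      also have "\<dots> \<le> (1 + \<rho>) / 2"
      proof -
        have "0 \<le> (?w - 1 / 2) * (1 - \<rho>)" using w \<rho>(1) by (intro mult_nonneg_nonneg) auto
        then show ?thesis by linarith
      qed
      also have "\<dots> \<le> c" unfolding c_def using fin by (intro Max_ge) auto
      finally show ?thesis ..
    qed
  qed
  ultimately show ?thesis by blast
next
  case False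
  with x have "1 < norm x" by simp
  then obtain \<psi> s y where \<psi>: "\<psi> \<in> \<B>" and s: "0 \<le> s" "s < 1" and x_eq: "x = (1 - s) *\<^sub>R V \<psi> + s *\<^sub>R y"
    and y: "norm y \<le> 1" "s \<noteq> 0 \<Longrightarrow> \<psi> y = 1"
    using in_pyramid[OF le] by blast
  have fx: "f x = (1 - s) * f (V \<psi>) + s * f y" for f :: "'a \<Rightarrow>\<^sub>L real"
    by (simp add: x_eq blinfun.add_right blinfun.scaleR_right)
  \<comment> \<open>For \<open>s \<noteq> 0\<close> the foot \<open>y\<close> lies on the unit
    sphere, because \<open>\<psi> y = 1\<close>, and the gap is taken there; for
    \<open>s = 0\<close> the value 0 is a placeholder.\<close>
  obtain \<rho> where \<rho>: "\<rho> < 1" "s \<noteq> 0 \<Longrightarrow> \<forall>\<phi>\<in>\<B>. \<phi> y = 1 \<or> \<phi> y \<le> \<rho>"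
  proof (cases "s = 0")
    case True
    then show ?thesis by (intro that[of 0]) auto
  next
    case False
    then have "norm y = 1" using y le_norm[OF \<psi>, of y] by simp
    then show ?thesis using gap that by blast
  qed
  define k where "k = T \<psi> / (2 + T \<psi>) * (1 - \<rho>)"
  define m where "m = (1 + T \<psi> + M \<psi>) / 2"
  have k: "0 < k" using T_pos[OF \<psi>] \<rho>(1) by (simp add: k_def)
  have m: "m < 1" using vertex_bound_less_one[OF \<psi>] by (simp add: m_def)
  \<comment> \<open>The entries bound the sides of the opposite pyramid, of all further pyramids,
    and of the pyramid containing \<open>x\<close>. At the apex, \<open>s = 0\<close>, the own sides
    all equal 1 and the third entry is a placeholder.\<close>
  define c where "c = max (2 * s - 1) (max ((1 - s) * m + s) (if s = 0 then 0 else 1 - s * k))"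
  have c_ge: "2 * s - 1 \<le> c" "(1 - s) * m + s \<le> c" "s \<noteq> 0 \<Longrightarrow> 1 - s * k \<le> c"
    by (auto simp: c_def le_max_iff_disj)
  have "(1 - s) * m < 1 - s" using mult_strict_left_mono[OF m, of "1 - s"] s by simp
  then have "(1 - s) * m + s < 1" using less_diff_eq by blast
  then have "c < 1" using s k by (auto simp: c_def)
  moreover have "g x = 1 \<or> g x \<le> c" if g: "g \<in> sides" for g
  proof -
    obtain \<phi> \<eta> where g_eq: "g = side \<phi> \<eta>" and p: "\<phi> \<in> \<B>" "\<eta> \<in> \<B>" "\<phi> \<noteq> \<eta>" "\<phi> \<noteq> - \<eta>"
      using sidesE[OF g] .
    have gy: "s * g y \<le> s" using sides_le_norm[OF g, of y] y(1) s by (simp add: mult_left_le)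
    consider "\<eta> = \<psi>" | "\<eta> = - \<psi>" | "\<eta> \<noteq> \<psi>" "\<eta> \<noteq> - \<psi>" by blast
    then show ?thesis
    proof cases
      case 1
      then have gV: "g (V \<psi>) = 1" using side_own_vertex[OF p] by (simp add: g_eq)
      show ?thesis
      proof (cases "s = 0 \<or> g y = 1")
        case True
        then show ?thesis using gV by (auto simp: fx)
      next
        case False
        let ?w = "weight \<phi> \<psi>"
        have w: "?w < 1" using weight_less_one[OF p] 1 by simp
        have gy': "g y = (1 - ?w) * \<phi> y + ?w" using y(2) False 1 by (simp add: g_eq side_apply)
        have "\<phi> y \<noteq> 1" using False gy' by auto
        then have "\<phi> y \<le> \<rho>" using \<rho>(2) False p by auto
        then have "g y \<le> (1 - ?w) * \<rho> + ?w" unfolding gy' using w by simp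
        also have "\<dots> = 1 - (1 - ?w) * (1 - \<rho>)" by (simp add: algebra_simps)
        also have "\<dots> \<le> 1 - k"
          using mult_right_mono[OF one_minus_weight_ge[OF p], of "1 - \<rho>"] 1 \<rho>(1) by (simp add: k_def)
        finally have "s * g y \<le> s * (1 - k)" using s by (intro mult_left_mono) auto
        then have "g x \<le> 1 - s * k" using gV by (simp add: fx algebra_simps)
        then show ?thesis using False c_ge(3) by auto
      qed
    next
      case 2
      then have "g (V \<psi>) = - 1"
        using side_own_vertex[OF p] V_minus[OF \<psi>] by (simp add: g_eq blinfun.minus_right)
      then have "g x \<le> 2 * s - 1" using gy by (simp add: fx)
      then show ?thesis using c_ge(1) by simp
    next
      case 3
      then have "\<psi> \<noteq> \<eta>" "\<psi> \<noteq> - \<eta>" by auto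
      then have "g (V \<psi>) \<le> m" using side_other_vertex[OF p \<psi>] by (simp add: g_eq m_def)
      then have "(1 - s) * g (V \<psi>) \<le> (1 - s) * m" using s by (intro mult_left_mono) auto
      then have "g x \<le> (1 - s) * m + s" using gy by (simp add: fx)
      then show ?thesis using c_ge(2) by simp
    qed
  qed
  ultimately show ?thesis by blast
qed

section \<open>The gauge of \<open>K\<close> as the supremum of the sides\<close>

lemma bdd_above_sides: "bdd_above ((\<lambda>g. blinfun_apply g y) ` sides)"
  by (rule bdd_aboveI2[OF sides_le_norm])

lemma SUP_sides_le_iff: "(SUP g\<in>sides. blinfun_apply g y) \<le> t \<longleftrightarrow> (\<forall>g\<in>sides. blinfun_apply g y \<le> t)"
  by (rule cSUP_le_iff[OF sides_nonempty bdd_above_sides])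

lemma SUP_sides_nonneg: "0 \<le> (SUP g\<in>sides. blinfun_apply g y)"
proof -
  obtain g where g: "g \<in> sides" using sides_nonempty by auto
  have "g y \<le> (SUP g\<in>sides. blinfun_apply g y)" "(- g) y \<le> (SUP g\<in>sides. blinfun_apply g y)"
    using g minus_sides[OF g] SUP_sides_le_iff by blast+
  then show ?thesis by (simp add: blinfun.minus_left)
qed

lemma in_scaled_K_iff: "0 < t \<Longrightarrow> y \<in> (\<lambda>u. t *\<^sub>R u) ` K \<longleftrightarrow> (SUP g\<in>sides. blinfun_apply g y) \<le> t"
proof -
  assume t: "0 < t"
  have "y \<in> (\<lambda>u. t *\<^sub>R u) ` K \<longleftrightarrow> (1 / t) *\<^sub>R y \<in> K"
    using t by (auto simp: image_iff intro!: bexI[of _ "(1 / t) *\<^sub>R y"])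
  also have "\<dots> \<longleftrightarrow> (SUP g\<in>sides. blinfun_apply g y) \<le> t"
    unfolding K_iff SUP_sides_le_iff using t by (simp add: blinfun.scaleR_right field_simps)
  finally show ?thesis .
qed

lemma minkowski_gauge_K: "minkowski_gauge K y = (SUP g\<in>sides. blinfun_apply g y)"
proof -
  let ?P = "SUP g\<in>sides. blinfun_apply g y"
  \<comment> \<open>The gauge admits only \<open>t > 0\<close>, so for \<open>?P = 0\<close> the set
    is an open ray; its infimum is still \<open>?P\<close>.\<close>
  have "{t. 0 < t \<and> y \<in> (\<lambda>u. t *\<^sub>R u) ` K} = (if ?P = 0 then {0<..} else {?P..})"
    using in_scaled_K_iff[of _ y] SUP_sides_nonneg[of y] by (auto simp: less_le)
  then show ?thesis by (simp add: minkowski_gauge_def)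
qed

lemma gauge_le_one_iff: "minkowski_gauge K y \<le> 1 \<longleftrightarrow> y \<in> K"
  by (simp add: minkowski_gauge_K SUP_sides_le_iff K_iff)

lemma norm_le_gauge: "norm y \<le> R * minkowski_gauge K y"
proof -
  have "norm y / R \<le> t" if t: "minkowski_gauge K y < t" for t
  proof -
    have t0: "0 < t" using t SUP_sides_nonneg[of y] by (simp add: minkowski_gauge_K)
    then have "y \<in> (\<lambda>u. t *\<^sub>R u) ` K" using t in_scaled_K_iff[of t y] by (simp add: minkowski_gauge_K)
    then obtain u where "u \<in> K" "y = t *\<^sub>R u" by auto
    then have "norm y \<le> t * R" using subset_ball t0 by (auto simp: subset_iff)
    then show ?thesis using R_pos by (simp add: field_simps)
  qed
  then have "norm y / R \<le> minkowski_gauge K y" by (rule dense_ge)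
  then show ?thesis using R_pos by (simp add: field_simps)
qed

lemma gauge_le_norm: "minkowski_gauge K y \<le> norm y"
  by (simp add: minkowski_gauge_K SUP_sides_le_iff sides_le_norm)

lemma sides_le_gauge: "g \<in> sides \<Longrightarrow> blinfun_apply g y \<le> minkowski_gauge K y"
  unfolding minkowski_gauge_K by (rule cSUP_upper[OF _ bdd_above_sides])

lemma equivalent_norm_gauge: "equivalent_norm (minkowski_gauge K)"
proof -
  have sub: "sublinear (minkowski_gauge K)"
    using sublinear_SUP_linear[of "blinfun_apply ` sides" norm] sides_nonempty sides_le_norm blinfun_linear
    by (auto simp: image_image minkowski_gauge_K[abs_def])
  have min: "minkowski_gauge K (- y) \<le> minkowski_gauge K y" for y
    unfolding minkowski_gauge_K SUP_sides_le_iff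
  proof
    fix g assume "g \<in> sides"
    then have "(- g) y \<le> (SUP g\<in>sides. blinfun_apply g y)" using minus_sides SUP_sides_le_iff by blast
    then show "g (- y) \<le> (SUP g\<in>sides. blinfun_apply g y)" by (simp add: blinfun.minus_left blinfun.minus_right)
  qed
  have minus: "minkowski_gauge K (- y) = minkowski_gauge K y" for y
    using min[of y] min[of "- y"] by simp
  have "minkowski_gauge K (c *\<^sub>R y) = \<bar>c\<bar> * minkowski_gauge K y" for c y
    using sublinear_scale[OF sub, of "\<bar>c\<bar>" y] minus[of "c *\<^sub>R y"] by (cases "0 \<le> c") auto
  moreover have "minkowski_gauge K y = 0 \<longleftrightarrow> y = 0" for y
    using norm_le_gauge[of y] sublinear_zero[OF sub] by auto
  ultimately have "is_norm (minkowski_gauge K)"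
    using sublinear_add[OF sub] by (auto simp: is_norm_def)
  moreover have "1 / R * norm y \<le> minkowski_gauge K y" for y
    using norm_le_gauge[of y] R_pos by (simp add: field_simps)
  ultimately show ?thesis
    unfolding equivalent_norm_def using gauge_le_norm R_pos
    by (intro conjI exI[of _ "1 / R"] exI[of _ 1]) auto
qed

lemma gauge_sides_gap:
  assumes "minkowski_gauge K x = 1"
  shows "\<exists>c<1. \<forall>g\<in>sides. blinfun_apply g x = 1 \<or> blinfun_apply g x \<le> c"
  using assms sides_le_gauge[of _ x] gauge_le_norm[of x] by (intro sides_gap) auto

lemma property_V_sides: "property_V (minkowski_gauge K) sides"
proof (rule property_VI)
  fix x assume x: "minkowski_gauge K x = 1"
  then obtain c where c: "c < 1" "\<And>g. g \<in> sides \<Longrightarrow> g x = 1 \<or> g x \<le> c" using gauge_sides_gap by blast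
  have "g x \<le> c" if "g \<in> sides - duality_set (minkowski_gauge K) x" for g
    using that c(2)[of g] sides_le_gauge by (auto simp: duality_set_iff[OF equivalent_norm_gauge x])
  then show "\<exists>c<1. \<forall>f\<in>sides - duality_set (minkowski_gauge K) x. f x \<le> c" using c(1) by blast
qed

lemma V_polyhedral_gauge: "V_polyhedral (minkowski_gauge K)"
  by (rule V_polyhedral_if_norming_gap[OF equivalent_norm_gauge sides_nonempty sides_le_gauge
        minkowski_gauge_K minus_sides gauge_sides_gap])

end

section \<open>The renorming\<close>

context renorming_construction
begin

section \<open>Tails of the index order and small values of \<open>\<theta>\<close>\<close>

lemma well_order: "Well_order r"
  using card_order by (simp add: card_order_on_def)

lemma r_refl: "\<gamma> \<in> Field r \<Longrightarrow> (\<gamma>, \<gamma>) \<in> r"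
  and r_trans: "trans r"
  and r_antisym: "antisym r"
  using well_order
  by (auto simp: well_order_on_def linear_order_on_def partial_order_on_def preorder_on_def
      refl_on_def)

lemma r_total: "\<gamma> \<in> Field r \<Longrightarrow> \<delta> \<in> Field r \<Longrightarrow> (\<gamma>, \<delta>) \<in> r \<or> (\<delta>, \<gamma>) \<in> r"
  using well_order r_refl
  by (cases "\<gamma> = \<delta>") (auto simp: well_order_on_def linear_order_on_def total_on_def)

lemma theta_bdd: "bdd_below (\<theta> ` above r \<eta>)"
  using theta_range by (intro bdd_belowI2[where m=0]) (auto simp: above_def Field_def intro: less_imp_le)

text \<open>A finite tail would attain its infimum 0, whereas \<open>\<theta>\<close> is positive.
  In particular no index is last.\<close>

lemma infinite_above:
  assumes "\<eta> \<in> Field r"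
  shows "infinite (above r \<eta>)"
proof
  assume fin: "finite (above r \<eta>)"
  have ne: "\<theta> ` above r \<eta> \<noteq> {}" using r_refl[OF assms] by (auto simp: above_def)
  then have "(INF \<gamma> \<in> above r \<eta>. \<theta> \<gamma>) \<in> \<theta> ` above r \<eta>"
    using fin by (simp add: cInf_eq_Min Min_in)
  then obtain \<gamma> where "\<gamma> \<in> above r \<eta>" "\<theta> \<gamma> = 0" using theta_inf[OF assms] by auto
  then show False using theta_range[of \<gamma>] by (auto simp: above_def Field_def)
qed

lemma ex_greater:
  assumes "\<eta> \<in> Field r"
  obtains \<gamma> where "\<gamma> \<in> Field r" "\<eta> \<in> underS r \<gamma>"
proof -
  have "infinite (above r \<eta> - {\<eta>})" using infinite_above[OF assms] by simp
  then obtain \<gamma> where "\<gamma> \<in> above r \<eta> - {\<eta>}" by (metis all_not_in_conv finite.emptyI)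
  then show ?thesis by (intro that[of \<gamma>]) (auto simp: above_def underS_def Field_def)
qed

lemma index_J_Field: "\<gamma> \<in> index_J r \<Longrightarrow> \<gamma> \<in> Field r"
  by (auto simp: index_J_def split: if_splits)

lemma index_J_upward:
  assumes "\<gamma> \<in> index_J r" "(\<gamma>, \<gamma>') \<in> r"
  shows "\<gamma>' \<in> index_J r"
proof -
  have "underS r \<gamma> \<subseteq> underS r \<gamma>'" using assms(2) by (rule underS_incr[OF r_trans r_antisym])
  moreover have "\<gamma>' \<in> Field r" using assms(2) by (auto simp: Field_def)
  ultimately show ?thesis using assms(1) unfolding index_J_def by (auto split: if_splits)
qed

text \<open>If the order type exceeds \<open>natLeq\<close>, some \<open>\<delta>\<close> has an
  initial segment of that type, and every index above \<open>\<delta>\<close> belongs to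
  \<open>index_J r\<close>.\<close>

lemma index_J_nonempty:
  assumes "Field r \<noteq> {}"
  shows "index_J r \<noteq> {}"
proof (cases "r =o natLeq")
  case True
  obtain \<eta> where "\<eta> \<in> Field r" using assms by auto
  then obtain \<gamma> where "\<gamma> \<in> Field r" "\<eta> \<in> underS r \<gamma>" by (rule ex_greater)
  then show ?thesis using True by (auto simp: index_J_def)
next
  case False
  obtain \<eta> where "\<eta> \<in> Field r" using assms by auto
  moreover have "above r \<eta> \<subseteq> Field r" by (auto simp: above_def Field_def)
  ultimately have "infinite (Field r)" using infinite_above finite_subset by blast
  then have "natLeq \<le>o r" using card_order natLeq_ordLeq_cinfinite[of r] by (simp add: cinfinite_def)
  then have "natLeq <o r" using False by (meson ordIso_symmetric ordLeq_iff_ordLess_or_ordIso)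
  then obtain \<delta> where \<delta>: "\<delta> \<in> Field r" "natLeq =o Restr r (underS r \<delta>)"
    using ordLess_iff_ordIso_Restr[OF well_order natLeq_Well_order] by blast
  then have iso: "Restr r (underS r \<delta>) =o natLeq" using ordIso_symmetric by blast
  obtain \<gamma> where "\<gamma> \<in> Field r" "\<delta> \<in> underS r \<gamma>" using \<delta>(1) by (rule ex_greater)
  then have "\<gamma> \<in> index_J r" using False iso by (auto simp: index_J_def)
  then show ?thesis by blast
qed

text \<open>\<open>index_J r\<close> is a final segment and \<open>\<theta>\<close> has infimum 0 on
  every tail, so the three demands can be met together far out.\<close>

lemma small_theta:
  assumes \<eta>: "\<eta> \<in> Field r" and d: "0 < d"
  obtains \<gamma> where "\<gamma> \<in> index_J r" "\<eta> \<in> underS r \<gamma>" "\<theta> \<gamma> < d"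
proof -
  obtain j where j: "j \<in> index_J r" using index_J_nonempty \<eta> by auto
  have "\<exists>m\<in>index_J r. (\<eta>, m) \<in> r"
    using r_total[OF \<eta> index_J_Field[OF j]] r_refl[OF \<eta>] index_J_upward[OF j] j by blast
  then obtain m where m: "m \<in> index_J r" "(\<eta>, m) \<in> r" by blast
  obtain \<gamma>0 where \<gamma>0: "\<gamma>0 \<in> Field r" "m \<in> underS r \<gamma>0" using index_J_Field[OF m(1)] by (rule ex_greater)
  have "above r \<gamma>0 \<noteq> {}" using r_refl[OF \<gamma>0(1)] by (auto simp: above_def)
  then obtain \<gamma> where \<gamma>: "(\<gamma>0, \<gamma>) \<in> r" "\<theta> \<gamma> < d"
    using cINF_less_iff[OF _ theta_bdd, of \<gamma>0 d] theta_inf[OF \<gamma>0(1)] d by (auto simp: above_def)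
  have m\<gamma>0: "(m, \<gamma>0) \<in> r" "m \<noteq> \<gamma>0" using \<gamma>0(2) by (auto simp: underS_def)
  have m\<gamma>: "(m, \<gamma>) \<in> r" using m\<gamma>0(1) \<gamma>(1) by (rule transD[OF r_trans])
  have "m \<noteq> \<gamma>" using m\<gamma>0 \<gamma>(1) r_antisym by (auto dest: antisymD)
  then have "\<eta> \<noteq> \<gamma>" using m(2) m\<gamma> r_antisym by (auto dest: antisymD)
  moreover have "(\<eta>, \<gamma>) \<in> r" using m(2) m\<gamma> by (rule transD[OF r_trans])
  ultimately have "\<eta> \<in> underS r \<gamma>" by (simp add: underS_def)
  moreover have "\<gamma> \<in> index_J r" using m(1) m\<gamma> by (rule index_J_upward)
  ultimately show ?thesis using \<gamma>(2) that by blast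
qed

lemma
  assumes "\<gamma> \<in> set_A_total r \<kappa> A"
  shows set_A_total_Field: "\<gamma> \<in> Field r"
    and ep_interior: "ep \<gamma> \<in> face_interior (fp \<gamma>)"
    and em_interior: "em \<gamma> \<in> face_interior (fm \<gamma>)"
  using assms A_finite e_interior unfolding set_A_total_def set_A_def by blast+

section \<open>Approximation of the unit ball by the vectors \<open>e \<gamma>\<close> and their
  negatives\<close>

lemma face_interior_face: "u \<in> face_interior f \<Longrightarrow> blinfun_apply f u = 1 \<and> norm u \<le> 1"
  by (auto simp: face_interior_iff)

lemma e_face:
  assumes "\<gamma> \<in> Field r"
  shows "blinfun_apply (fp \<gamma>) (e \<gamma>) = 1" and "norm (e \<gamma>) \<le> 1"
proof -
  have "fp \<gamma> (e \<gamma>) = 1 \<and> norm (e \<gamma>) \<le> 1"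
  proof (cases "\<gamma> \<in> set_A_total r \<kappa> A")
    case True
    show ?thesis
    proof (cases "lm \<gamma> \<le> lp \<gamma>")
      case lm: True
      then show ?thesis
        using face_interior_face[OF ep_interior[OF True]] by (simp add: e_plus[OF True])
    next
      case False
      then show ?thesis
        using face_interior_face[OF em_interior[OF True]]
        by (simp add: e_minus[OF True] fm_eq[OF assms] blinfun.minus_left blinfun.minus_right)
    qed
  qed (use e_other assms face_interior_face in blast)
  then show "fp \<gamma> (e \<gamma>) = 1" "norm (e \<gamma>) \<le> 1" by auto
qed

text \<open>The new ball with every factor \<open>1 + \<tau> \<gamma>\<close> replaced by 1; placing
  the unit ball inside this smaller set keeps the approximation argument free of
  \<open>\<tau>\<close>.\<close>

definition core :: "'a set" where
  "core = closure (convex hull (e ` Field r \<union> (\<lambda>\<gamma>. - e \<gamma>) ` Field r))"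

lemma convex_core: "convex core" and closed_core: "closed core"
  by (simp_all add: core_def convex_closure)

lemma e_in_core: "\<gamma> \<in> Field r \<Longrightarrow> e \<gamma> \<in> core" "\<gamma> \<in> Field r \<Longrightarrow> - e \<gamma> \<in> core"
  unfolding core_def by (intro subsetD[OF closure_subset] hull_inc; simp)+

text \<open>It contains every \<open>set_W\<close> of the construction together with all the vectors
  \<open>ep w\<close>, \<open>em w\<close> that approximate their members.\<close>

definition points :: "'a set" where
  "points = x ` Field r \<union> (\<Union>\<delta>\<in>index_J r. set_E r \<kappa> A ep em \<delta>)"

lemma points_norm: "u \<in> points \<Longrightarrow> norm u \<le> 1"
proof -
  assume "u \<in> points"
  then consider "u \<in> x ` Field r" | w where "w \<in> set_A_total r \<kappa> A" "u = ep w \<or> u = em w"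
    unfolding points_def set_E_def set_A_total_def by blast
  then show ?thesis
  proof cases
    case 1
    then show ?thesis using x_in_ball by auto
  next
    case 2
    then show ?thesis
      using face_interior_face[OF ep_interior[OF 2(1)]] face_interior_face[OF em_interior[OF 2(1)]] by auto
  qed
qed

text \<open>Once entered in \<open>set_W\<close> a point stays at all later stages, so it is
  approximated with errors \<open>\<theta> \<gamma>\<close> as small as desired.\<close>

lemma points_in_W:
  assumes "u \<in> points"
  obtains \<eta> where "\<eta> \<in> Field r"
    "\<And>\<gamma>. \<gamma> \<in> index_J r \<Longrightarrow> \<eta> \<in> underS r \<gamma> \<Longrightarrow> u \<in> set_W r x \<kappa> A ep em \<gamma>"
  using assms unfolding points_def
proof (elim UnE imageE UN_E)
  fix \<eta> assume "u = x \<eta>" "\<eta> \<in> Field r"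
  then show ?thesis by (intro that[of \<eta>]) (auto simp: set_W_def)
next
  fix \<delta> assume "\<delta> \<in> index_J r" "u \<in> set_E r \<kappa> A ep em \<delta>"
  then show ?thesis using index_J_Field by (intro that[of \<delta>]) (auto simp: set_W_def)
qed

end

text \<open>The larger weight \<open>s\<close> falls on a point of \<open>C\<close> itself, so only
  the share \<open>t\<close>, at most half of the total, pays the error \<open>D\<close>.\<close>

lemma convex_pair_approx:
  fixes a b b' :: "'a::real_normed_vector"
  assumes C: "convex C" "a \<in> C" "b' \<in> C" and b: "norm (b - b') \<le> D" and st: "0 \<le> t" "t \<le> s"
  obtains u where "u \<in> C" "norm ((s *\<^sub>R a + t *\<^sub>R b) - (s + t) *\<^sub>R u) \<le> (s + t) / 2 * D"
proof (cases "s + t = 0")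
  case True
  then have "s = 0" "t = 0" using st by auto
  then show ?thesis using C(2) by (intro that[of a]) auto
next
  case False
  with st have pos: "0 < s + t" by simp
  let ?u = "(s / (s + t)) *\<^sub>R a + (t / (s + t)) *\<^sub>R b'"
  have "?u \<in> C"
    using pos st by (intro convexD[OF C]) (auto simp: add_divide_distrib[symmetric])
  moreover have "(s *\<^sub>R a + t *\<^sub>R b) - (s + t) *\<^sub>R ?u = t *\<^sub>R (b - b')"
    using pos by (simp add: scaleR_add_right scaleR_diff_right)
  moreover have "norm (t *\<^sub>R (b - b')) \<le> (s + t) / 2 * D"
  proof -
    have "0 \<le> D" using b norm_ge_zero order_trans by blast
    have "norm (t *\<^sub>R (b - b')) \<le> t * D" using b st by (simp add: mult_left_mono)
    also have "\<dots> \<le> (s + t) / 2 * D" using st \<open>0 \<le> D\<close> by (intro mult_right_mono) auto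
    finally show ?thesis .
  qed
  ultimately show ?thesis by (intro that[of ?u]) auto
qed

context renorming_construction
begin

text \<open>Halving step: a point of \<open>points\<close> is nearly a convex combination of \<open>e\<^sup>+\<close>'s and \<open>e\<^sup>-\<close>'s in which
  at least half of the total weight sits on vectors \<open>\<plusminus>e\<^sub>w\<close> of the core, and the other vectors
  again belong to \<open>points\<close>.\<close>

lemma points_near_core_step:
  assumes near: "\<And>u d. 0 < d \<Longrightarrow> u \<in> points \<Longrightarrow> \<exists>a\<in>core. norm (u - a) \<le> D + d"
    and u: "u \<in> points" and d: "0 < d"
  shows "\<exists>a\<in>core. norm (u - a) \<le> D / 2 + d"
proof -
  obtain \<eta>0 where \<eta>0: "\<eta>0 \<in> Field r"
    and W: "\<And>\<gamma>. \<gamma> \<in> index_J r \<Longrightarrow> \<eta>0 \<in> underS r \<gamma> \<Longrightarrow> u \<in> set_W r x \<kappa> A ep em \<gamma>"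
    using points_in_W[OF u] by blast
  \<comment> \<open>Half of \<open>d\<close> is reserved for \<open>\<theta> \<gamma>\<close>; the
    other half arises from \<open>(D + d) / 2 = D / 2 + d / 2\<close>.\<close>
  obtain \<gamma> where \<gamma>: "\<gamma> \<in> index_J r" "\<eta>0 \<in> underS r \<gamma>" "\<theta> \<gamma> < d / 2"
    using small_theta[OF \<eta>0, of "d / 2"] d by auto
  then obtain \<eta> where \<eta>: "\<eta> \<in> underS r (\<kappa> \<gamma>)" and u_eq: "u = z \<gamma> \<eta>"
    using W z_enum[OF \<gamma>(1)] by blast
  note A = A_finite[OF \<gamma>(1) \<eta>]
  have "\<exists>v. v \<in> core \<and>
    norm ((lp w *\<^sub>R ep w + lm w *\<^sub>R em w) - (lp w + lm w) *\<^sub>R v) \<le> (lp w + lm w) / 2 * (D + d)"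
    if w: "w \<in> A \<gamma> \<eta>" for w
  proof -
    have wA: "w \<in> set_A_total r \<kappa> A" using w \<gamma>(1) \<eta> by (auto simp: set_A_total_def set_A_def)
    note wF = set_A_total_Field[OF wA]
    have pts: "ep w \<in> points" "em w \<in> points"
      using w \<gamma>(1) \<eta> unfolding points_def set_E_def set_A_def by blast+
    have l: "0 \<le> lp w" "0 \<le> lm w" using l_nonneg[OF \<gamma>(1) \<eta> w] by auto
    show ?thesis
    \<comment> \<open>The sign in the choice of \<open>e w\<close> follows the larger coefficient,
      so the vector with the larger coefficient is in the core and only the other one needs
      \<open>near\<close>.\<close>
    proof (cases "lm w \<le> lp w")
      case True
      obtain a where a: "a \<in> core" "norm (em w - a) \<le> D + d" using near[OF d pts(2)] by blast
      have "ep w \<in> core" using e_plus[OF wA True] e_in_core(1)[OF wF] by simp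
      then show ?thesis
        using convex_pair_approx[OF convex_core _ a l(2) True, of "ep w"] by blast
    next
      case False
      then have lt: "lp w < lm w" by simp
      obtain a where a: "a \<in> core" "norm (ep w - a) \<le> D + d" using near[OF d pts(1)] by blast
      have "em w \<in> core" using e_minus[OF wA lt] e_in_core(2)[OF wF] by simp
      then show ?thesis
        using convex_pair_approx[OF convex_core _ a l(1) less_imp_le[OF lt], of "em w"]
        by (metis add.commute)
    qed
  qed
  then obtain v where v: "\<And>w. w \<in> A \<gamma> \<eta> \<Longrightarrow> v w \<in> core"
    "\<And>w. w \<in> A \<gamma> \<eta> \<Longrightarrow> norm ((lp w *\<^sub>R ep w + lm w *\<^sub>R em w) - (lp w + lm w) *\<^sub>R v w)
        \<le> (lp w + lm w) / 2 * (D + d)"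
    by metis
  let ?a = "\<Sum>w\<in>A \<gamma> \<eta>. (lp w + lm w) *\<^sub>R v w"
  let ?z = "\<Sum>w\<in>A \<gamma> \<eta>. lp w *\<^sub>R ep w + lm w *\<^sub>R em w"
  have "?a \<in> core"
    using A l_sum[OF \<gamma>(1) \<eta>] l_nonneg[OF \<gamma>(1) \<eta>] v(1)
    by (intro convex_sum[OF _ convex_core]) auto
  moreover have "norm (?z - ?a) \<le> (D + d) / 2"
  proof -
    have "norm (?z - ?a) \<le> (\<Sum>w\<in>A \<gamma> \<eta>. (lp w + lm w) / 2 * (D + d))"
      unfolding sum_subtractf[symmetric] by (rule sum_norm_le) (rule v(2))
    also have "\<dots> = (\<Sum>w\<in>A \<gamma> \<eta>. lp w + lm w) / 2 * (D + d)"
      by (simp only: sum_distrib_right[symmetric] sum_divide_distrib[symmetric])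
    finally show ?thesis by (simp add: l_sum[OF \<gamma>(1) \<eta>])
  qed
  moreover have "norm (u - ?z) < d / 2"
    using z_approx[OF \<gamma>(1) \<eta>] \<gamma>(3) by (simp add: u_eq dist_norm norm_minus_commute)
  moreover have "norm (u - ?a) \<le> norm (u - ?z) + norm (?z - ?a)"
    using norm_triangle_ineq[of "u - ?z" "?z - ?a"] by simp
  ultimately have "norm (u - ?a) \<le> D / 2 + d" by (simp add: field_simps)
  with \<open>?a \<in> core\<close> show ?thesis by blast
qed

text \<open>The initial bound 2 is the diameter of the unit ball. The slack \<open>d\<close> stays
  arbitrary in the induction because the halving step asks for every positive slack.\<close>

lemma points_near_core:
  assumes "0 < d" "u \<in> points"
  shows "\<exists>a\<in>core. norm (u - a) \<le> 2 / 2 ^ n + d"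
  using assms
proof (induction n arbitrary: d u)
  case 0
  obtain \<eta> where "\<eta> \<in> Field r" using points_in_W[OF 0(2)] by blast
  then have "e \<eta> \<in> core" "norm (e \<eta>) \<le> 1" using e_in_core e_face by auto
  moreover have "norm (u - e \<eta>) \<le> norm u + norm (e \<eta>)" by (rule norm_triangle_ineq4)
  ultimately have "norm (u - e \<eta>) \<le> 2 / 2 ^ 0 + d" using points_norm[OF 0(2)] 0(1) by simp
  with \<open>e \<eta> \<in> core\<close> show ?case by blast
next
  case (Suc n)
  have "\<exists>a\<in>core. norm (u - a) \<le> 2 / 2 ^ n / 2 + d"
    by (rule points_near_core_step[OF Suc.IH Suc.prems(2,1)])
  moreover have "2 / 2 ^ n / 2 = (2 :: real) / 2 ^ Suc n" by simp
  ultimately show ?case by (simp only:)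
qed

lemma points_subset_core: "points \<subseteq> core"
proof
  fix u assume u: "u \<in> points"
  have "u \<in> closure core"
    unfolding closure_approachable
  proof (intro allI impI)
    fix c :: real assume c: "0 < c"
    obtain n where "(1 / 2) ^ n < c / 4" using real_arch_pow_inv[of "c / 4" "1 / 2"] c by auto
    moreover have "2 / 2 ^ n = 2 * (1 / 2 :: real) ^ n" by (simp add: power_one_over)
    ultimately have n: "2 / 2 ^ n < c / 2" by linarith
    obtain a where a: "a \<in> core" "norm (u - a) \<le> 2 / 2 ^ n + c / 4"
      using points_near_core[OF _ u, of "c / 4" n] c by fastforce
    then have "dist a u < c" using n c unfolding dist_norm norm_minus_commute[of a u] by linarith
    with a show "\<exists>y\<in>core. dist y u < c" by blast
  qed
  then show "u \<in> core" using closed_core by (simp add: closure_closed)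
qed

lemma ball_subset_core: "cball 0 1 \<subseteq> core"
proof -
  have "x ` Field r \<subseteq> core" using points_subset_core by (auto simp: points_def)
  then show ?thesis using x_dense closure_minimal[OF _ closed_core] by blast
qed

section \<open>Identification of the new ball with the abstract pyramids\<close>

definition vertex :: "'i \<Rightarrow> 'a" where
  "vertex \<gamma> = (1 + \<tau> \<gamma>) *\<^sub>R e \<gamma>"

lemma new_ball_eq:
  "new_ball r e \<tau> = closure (convex hull (vertex ` Field r \<union> (\<lambda>\<gamma>. - vertex \<gamma>) ` Field r))"
  by (simp add: new_ball_def vertex_def)

lemma core_subset_new_ball: "core \<subseteq> new_ball r e \<tau>"
proof -
  have conv: "convex (new_ball r e \<tau>)" and clos: "closed (new_ball r e \<tau>)"
    by (simp_all add: new_ball_eq convex_closure)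
  have mem: "c *\<^sub>R e \<gamma> \<in> new_ball r e \<tau>" if \<gamma>: "\<gamma> \<in> Field r" and c: "\<bar>c\<bar> \<le> 1" for c \<gamma>
  proof -
    define t where "t = 1 + \<tau> \<gamma>"
    have t: "1 < t" using tau_range[OF \<gamma>] by (simp add: t_def)
    have v: "vertex \<gamma> \<in> new_ball r e \<tau>" "- vertex \<gamma> \<in> new_ball r e \<tau>"
      unfolding new_ball_eq using \<gamma> by (intro subsetD[OF closure_subset] hull_inc; simp)+
    have "\<bar>c / t\<bar> \<le> 1" using c t by (simp add: abs_divide field_simps)
    then have ct: "- 1 \<le> c / t" "c / t \<le> 1" by linarith+
    \<comment> \<open>The point at position \<open>c / t\<close> on the segment between the two
      opposite vertices.\<close>
    have "((1 + c / t) / 2) *\<^sub>R vertex \<gamma> + ((1 - c / t) / 2) *\<^sub>R (- vertex \<gamma>) \<in> new_ball r e \<tau>"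
      using ct by (intro convexD[OF conv v]) (auto simp: field_simps)
    also have "((1 + c / t) / 2) *\<^sub>R vertex \<gamma> + ((1 - c / t) / 2) *\<^sub>R (- vertex \<gamma>)
        = ((1 + c / t) / 2 - (1 - c / t) / 2) *\<^sub>R vertex \<gamma>"
      by (simp add: scaleR_diff_left)
    also have "(1 + c / t) / 2 - (1 - c / t) / 2 = c / t" by (simp add: field_simps)
    also have "(c / t) *\<^sub>R vertex \<gamma> = c *\<^sub>R e \<gamma>" using t by (simp add: vertex_def t_def[symmetric])
    finally show ?thesis .
  qed
  have "e ` Field r \<union> (\<lambda>\<gamma>. - e \<gamma>) ` Field r \<subseteq> new_ball r e \<tau>"
    using mem[of _ 1] mem[of _ "- 1"] by auto
  then show ?thesis unfolding core_def by (intro closure_minimal hull_minimal conv clos)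
qed

lemma new_ball_subset: "new_ball r e \<tau> \<subseteq> cball 0 (1 + \<epsilon>)"
proof -
  have "norm (vertex \<gamma>) \<le> 1 + \<epsilon>" if \<gamma>: "\<gamma> \<in> Field r" for \<gamma>
  proof -
    have "norm (vertex \<gamma>) = (1 + \<tau> \<gamma>) * norm (e \<gamma>)" using tau_range[OF \<gamma>] by (simp add: vertex_def)
    also have "\<dots> \<le> (1 + \<epsilon>) * 1" using tau_range[OF \<gamma>] e_face[OF \<gamma>] by (intro mult_mono) auto
    finally show ?thesis by simp
  qed
  then have "vertex ` Field r \<union> (\<lambda>\<gamma>. - vertex \<gamma>) ` Field r \<subseteq> cball 0 (1 + \<epsilon>)" by auto
  then show ?thesis unfolding new_ball_eq by (intro closure_minimal hull_minimal) auto
qed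

lemma fp_minimal: "\<gamma> \<in> Field r \<Longrightarrow> fp \<gamma> \<in> minimal_boundary"
  and fm_minimal: "\<gamma> \<in> Field r \<Longrightarrow> fm \<gamma> \<in> minimal_boundary"
  using boundary_split by auto

lemma fp_le_norm: "\<gamma> \<in> Field r \<Longrightarrow> \<bar>blinfun_apply (fp \<gamma>) u\<bar> \<le> norm u"
  using norm_blinfun[of "fp \<gamma>" u] fp_minimal[of \<gamma>] by (simp add: minimal_boundary_iff)

lemma fp_e_le_mu:
  assumes "\<gamma> \<in> Field r" "\<xi> \<in> Field r" "\<xi> \<noteq> \<gamma>"
  shows "\<bar>blinfun_apply (fp \<xi>) (e \<gamma>)\<bar> \<le> mu r fp e \<gamma>"
  unfolding mu_def
proof (rule cSUP_upper)
  show "bdd_above ((\<lambda>\<xi>. \<bar>blinfun_apply (fp \<xi>) (e \<gamma>)\<bar>) ` (Field r - {\<gamma>}))"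
  proof (rule bdd_aboveI2[where M=1])
    fix \<zeta> assume "\<zeta> \<in> Field r - {\<gamma>}"
    then show "\<bar>blinfun_apply (fp \<zeta>) (e \<gamma>)\<bar> \<le> 1"
      using fp_le_norm[of \<zeta> "e \<gamma>"] e_face(2)[OF assms(1)] by simp
  qed
qed (use assms in auto)

definition index_of :: "('a \<Rightarrow>\<^sub>L real) \<Rightarrow> 'i" where
  "index_of \<psi> = (THE \<gamma>. \<gamma> \<in> Field r \<and> (\<psi> = fp \<gamma> \<or> \<psi> = fm \<gamma>))"

lemma fp_eq_iff: "\<gamma> \<in> Field r \<Longrightarrow> \<xi> \<in> Field r \<Longrightarrow> fp \<gamma> = fp \<xi> \<longleftrightarrow> \<gamma> = \<xi>"
  and fm_eq_iff: "\<gamma> \<in> Field r \<Longrightarrow> \<xi> \<in> Field r \<Longrightarrow> fm \<gamma> = fm \<xi> \<longleftrightarrow> \<gamma> = \<xi>"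
  and fp_neq_fm: "\<gamma> \<in> Field r \<Longrightarrow> \<xi> \<in> Field r \<Longrightarrow> fp \<gamma> \<noteq> fm \<xi>"
  using inj_fp inj_fm boundary_disjoint by (auto simp: inj_on_eq_iff)

lemma index_of_fp: "\<gamma> \<in> Field r \<Longrightarrow> index_of (fp \<gamma>) = \<gamma>"
  and index_of_fm: "\<gamma> \<in> Field r \<Longrightarrow> index_of (fm \<gamma>) = \<gamma>"
  unfolding index_of_def using fp_eq_iff fm_eq_iff fp_neq_fm
  by (intro the_equality; metis)+

text \<open>The sign makes the apex an odd function of the functional, so that its values on the
  minimal boundary are exactly the generators of the new ball.\<close>

definition vertex_of :: "('a \<Rightarrow>\<^sub>L real) \<Rightarrow> 'a" where
  "vertex_of \<psi> = (if \<psi> \<in> fp ` Field r then vertex (index_of \<psi>) else - vertex (index_of \<psi>))"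

lemma vertex_of_fp: "\<gamma> \<in> Field r \<Longrightarrow> vertex_of (fp \<gamma>) = vertex \<gamma>"
  and vertex_of_fm: "\<gamma> \<in> Field r \<Longrightarrow> vertex_of (fm \<gamma>) = - vertex \<gamma>"
  using boundary_disjoint by (auto simp: vertex_of_def index_of_fp index_of_fm)

lemma minimal_boundaryE:
  assumes "\<psi> \<in> minimal_boundary"
  obtains \<gamma> where "\<gamma> \<in> Field r" "\<psi> = fp \<gamma>" | \<gamma> where "\<gamma> \<in> Field r" "\<psi> = fm \<gamma>"
  using assms unfolding boundary_split by blast

lemma minus_fp: "\<gamma> \<in> Field r \<Longrightarrow> - fp \<gamma> = fm \<gamma>"
  and minus_fm: "\<gamma> \<in> Field r \<Longrightarrow> - fm \<gamma> = fp \<gamma>"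
  by (simp_all add: fm_eq)

lemma fp_vertex_other:
  assumes "\<gamma> \<in> Field r" "\<xi> \<in> Field r" "\<xi> \<noteq> \<gamma>"
  shows "\<bar>blinfun_apply (fp \<xi>) (vertex \<gamma>)\<bar> \<le> (1 + \<tau> \<gamma>) * mu r fp e \<gamma>"
  using fp_e_le_mu[OF assms] tau_range[OF assms(1)]
  by (simp add: vertex_def blinfun.scaleR_right abs_mult mult_left_mono)

text \<open>Attainment and gaps come from (IV), the inclusion of the unit ball from the halving
  argument, the height condition from \<open>tau_mu\<close>; a further functional exists because no
  index is last.\<close>

lemma facet_vertices:
  assumes IV: "IV_polyhedral (norm :: 'a \<Rightarrow> real)" and nontriv: "(u0 :: 'a) \<noteq> 0" and eps: "0 < \<epsilon>"
  shows "facet_vertices minimal_boundary vertex_of (\<lambda>\<psi>. \<tau> (index_of \<psi>))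
    (\<lambda>\<psi>. (1 + \<tau> (index_of \<psi>)) * mu r fp e (index_of \<psi>)) (new_ball r e \<tau>) (1 + \<epsilon>)"
proof
  note simps = index_of_fp index_of_fm vertex_of_fp vertex_of_fm minus_fp minus_fm
  show "(minimal_boundary :: ('a \<Rightarrow>\<^sub>L real) set) \<noteq> {}"
    using minimal_boundary_attains[OF IV, of "(1 / norm u0) *\<^sub>R u0"] nontriv by auto
  show "cball 0 1 \<subseteq> new_ball r e \<tau>" using ball_subset_core core_subset_new_ball by blast
  show "new_ball r e \<tau> \<subseteq> cball 0 (1 + \<epsilon>)" by (rule new_ball_subset)
  show "0 < 1 + \<epsilon>" using eps by simp
  show "new_ball r e \<tau> = closure (convex hull vertex_of ` minimal_boundary)"
    by (simp add: new_ball_eq boundary_split image_Un image_image simps cong: image_cong)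
  fix y :: 'a assume y: "norm y = 1"
  obtain \<rho> where \<rho>: "\<rho> < 1" "finite {f \<in> ext_dual_ball norm. blinfun_apply f y = 1}"
    "\<And>f. f \<in> ext_dual_ball norm \<Longrightarrow> blinfun_apply f y \<noteq> 1 \<Longrightarrow> blinfun_apply f y \<le> \<rho>"
    using IV_polyhedral_gap[OF IV y] by blast
  show "\<exists>\<psi>\<in>minimal_boundary. \<psi> y = 1" using minimal_boundary_attains[OF IV y] by blast
  show "finite {\<psi> \<in> minimal_boundary. \<psi> y = 1}"
    by (rule finite_subset[OF _ \<rho>(2)]) (use minimal_boundary_subset_ext in auto)
  show "\<exists>\<rho><1. \<forall>\<psi>\<in>minimal_boundary. \<psi> y = 1 \<or> \<psi> y \<le> \<rho>"
    using \<rho>(1,3) minimal_boundary_subset_ext by blast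
next
  fix \<psi> :: "'a \<Rightarrow>\<^sub>L real" assume \<psi>: "\<psi> \<in> minimal_boundary"
  note simps = index_of_fp index_of_fm vertex_of_fp vertex_of_fm minus_fp minus_fm
    blinfun.minus_left blinfun.minus_right
  show "\<psi> y \<le> norm y" for y
    using \<psi> by (intro dual_ball_apply_le) (simp add: minimal_boundary_iff)
  obtain \<gamma> where \<gamma>: "\<gamma> \<in> Field r" and \<psi>\<gamma>: "\<psi> = fp \<gamma> \<or> \<psi> = fm \<gamma>" using minimal_boundaryE[OF \<psi>] by metis
  then have ix: "index_of \<psi> = \<gamma>" by (auto simp: simps)
  show "- \<psi> \<in> minimal_boundary" using \<psi>\<gamma> \<gamma> by (auto simp: simps fp_minimal fm_minimal)
  show "vertex_of (- \<psi>) = - vertex_of \<psi>" using \<psi>\<gamma> \<gamma> by (auto simp: simps)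
  show "\<tau> (index_of (- \<psi>)) = \<tau> (index_of \<psi>)" using \<psi>\<gamma> \<gamma> by (auto simp: simps)
  show "0 < \<tau> (index_of \<psi>)" using tau_range[OF \<gamma>] by (simp add: ix)
  have "fp \<gamma> (vertex \<gamma>) = 1 + \<tau> \<gamma>" by (simp add: vertex_def blinfun.scaleR_right e_face[OF \<gamma>])
  moreover have "fm \<gamma> (- vertex \<gamma>) = fp \<gamma> (vertex \<gamma>)"
    by (simp add: fm_eq[OF \<gamma>] blinfun.minus_left blinfun.minus_right)
  ultimately show "\<psi> (vertex_of \<psi>) = 1 + \<tau> (index_of \<psi>)"
    using \<psi>\<gamma> unfolding ix by (auto simp: \<gamma> vertex_of_fp vertex_of_fm)
  show "(1 + \<tau> (index_of \<psi>)) * mu r fp e (index_of \<psi>) < 1 - \<tau> (index_of \<psi>)"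
    using tau_mu[OF \<gamma>] by (simp add: ix algebra_simps)
  obtain \<xi> where \<xi>: "\<xi> \<in> Field r" "\<gamma> \<in> underS r \<xi>" using \<gamma> by (rule ex_greater)
  then have "\<xi> \<noteq> \<gamma>" by (auto simp: underS_def)
  then have "fp \<xi> \<noteq> \<psi>" "fp \<xi> \<noteq> - \<psi>"
    using \<psi>\<gamma> \<gamma> \<xi>(1) fp_eq_iff fp_neq_fm by (auto simp: minus_fp minus_fm)
  then show "\<exists>\<phi>\<in>minimal_boundary. \<phi> \<noteq> \<psi> \<and> \<phi> \<noteq> - \<psi>" using fp_minimal[OF \<xi>(1)] by blast
  fix \<phi> :: "'a \<Rightarrow>\<^sub>L real" assume \<phi>: "\<phi> \<in> minimal_boundary" "\<phi> \<noteq> \<psi>" "\<phi> \<noteq> - \<psi>"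
  obtain \<zeta> where \<zeta>: "\<zeta> \<in> Field r" and \<phi>\<zeta>: "\<phi> = fp \<zeta> \<or> \<phi> = fm \<zeta>" using minimal_boundaryE[OF \<phi>(1)] by metis
  have "\<zeta> \<noteq> \<gamma>" using \<phi>(2,3) \<phi>\<zeta> \<psi>\<gamma> \<gamma> by (auto simp: minus_fp minus_fm)
  have "\<bar>\<phi> (vertex_of \<psi>)\<bar> = \<bar>fp \<zeta> (vertex \<gamma>)\<bar>"
    using \<phi>\<zeta> \<psi>\<gamma> by (auto simp: \<gamma> \<zeta> vertex_of_fp vertex_of_fm fm_eq[OF \<zeta>] blinfun.minus_left blinfun.minus_right)
  then show "\<bar>\<phi> (vertex_of \<psi>)\<bar> \<le> (1 + \<tau> (index_of \<psi>)) * mu r fp e (index_of \<psi>)"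
    using fp_vertex_other[OF \<gamma> \<zeta> \<open>\<zeta> \<noteq> \<gamma>\<close>] by (simp add: ix)
qed

end

theorem theorem5p4:
  fixes \<epsilon> :: real
    and r :: "'i rel"
    and fp fm :: "'i \<Rightarrow> 'a::banach \<Rightarrow>\<^sub>L real"
    and \<theta> \<tau> lp lm :: "'i \<Rightarrow> real"
    and x ep em e :: "'i \<Rightarrow> 'a"
    and \<kappa> :: "'i \<Rightarrow> 'i"
    and z :: "'i \<Rightarrow> 'i \<Rightarrow> 'a"
    and A :: "'i \<Rightarrow> 'i \<Rightarrow> 'i set"
  assumes infinite_dimensional: "\<nexists>S :: 'a set. finite S \<and> span S = UNIV"
    and IV: "IV_polyhedral (norm :: 'a \<Rightarrow> real)"
    and eps: "0 < \<epsilon>"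
    and constr: "renorming_construction \<epsilon> r fp fm \<theta> x \<kappa> z A ep em lp lm e \<tau>"
  shows "property_V (new_norm r e \<tau>) (new_functionals r fp fm e \<tau>) \<and>
         is_banach_norm (new_norm r e \<tau>) \<and>
         equivalent_norm (new_norm r e \<tau>) \<and>
         {y. new_norm r e \<tau> y \<le> 1} = new_ball r e \<tau> \<and>
         V_polyhedral (new_norm r e \<tau>)"
proof -
  interpret C: renorming_construction \<epsilon> r fp fm \<theta> x \<kappa> z A ep em lp lm e \<tau> by (rule constr)
  have "span ({} :: 'a set) \<noteq> UNIV" using infinite_dimensional by blast
  then obtain u0 :: 'a where u0: "u0 \<noteq> 0" by auto
  interpret F: facet_vertices minimal_boundary C.vertex_of "\<lambda>\<psi>. \<tau> (C.index_of \<psi>)"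
    "\<lambda>\<psi>. (1 + \<tau> (C.index_of \<psi>)) * mu r fp e (C.index_of \<psi>)" "new_ball r e \<tau>" "1 + \<epsilon>"
    by (rule C.facet_vertices[OF IV u0 eps])
  have side_cond: "\<phi> \<noteq> \<psi> \<and> \<phi> \<noteq> - \<psi>"
    if "\<gamma> \<in> Field r" "\<xi> \<in> Field r" "\<xi> \<noteq> \<gamma>" "\<phi> = fp \<xi> \<or> \<phi> = fm \<xi>" "\<psi> = fp \<gamma> \<or> \<psi> = fm \<gamma>" for \<gamma> \<xi> \<phi> \<psi>
  proof -
    have "fp \<xi> \<noteq> fp \<gamma>" "fm \<xi> \<noteq> fm \<gamma>" "fp \<xi> \<noteq> fm \<gamma>" "fm \<xi> \<noteq> fp \<gamma>"
      using that(1-3) C.fp_eq_iff C.fm_eq_iff C.fp_neq_fm by metis+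
    then show ?thesis
      using that(4,5) C.minus_fp[OF that(1)] C.minus_fm[OF that(1)] by metis
  qed
  have g: "g_plus fp e \<tau> \<xi> \<gamma> = F.side (fp \<xi>) (fp \<gamma>)" "g_minus fp fm e \<tau> \<xi> \<gamma> = F.side (fm \<xi>) (fp \<gamma>)"
    "- F.side (fp \<xi>) (fp \<gamma>) = F.side (fm \<xi>) (fm \<gamma>)" "- F.side (fm \<xi>) (fp \<gamma>) = F.side (fp \<xi>) (fm \<gamma>)"
    if "\<gamma> \<in> Field r" "\<xi> \<in> Field r" "\<xi> \<noteq> \<gamma>" for \<gamma> \<xi>
  proof -
    have v: "(1 + \<tau> \<gamma>) *\<^sub>R e \<gamma> = C.vertex_of (fp \<gamma>)"
      unfolding C.vertex_of_fp[OF that(1)] C.vertex_def ..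
    note p = C.fp_minimal[OF that(2)] C.fp_minimal[OF that(1)]
    note m = C.fm_minimal[OF that(2)] C.fp_minimal[OF that(1)]
    have np: "fp \<xi> \<noteq> fp \<gamma>" "fp \<xi> \<noteq> - fp \<gamma>" and nm: "fm \<xi> \<noteq> fp \<gamma>" "fm \<xi> \<noteq> - fp \<gamma>"
      using side_cond[OF that] by blast+
    note minus = C.minus_fp[OF that(1)] C.minus_fp[OF that(2)] C.minus_fm[OF that(2)]
    show "g_plus fp e \<tau> \<xi> \<gamma> = F.side (fp \<xi>) (fp \<gamma>)"
      unfolding g_plus_def v by (rule F.combination_at_eq_side[OF p np])
    show "g_minus fp fm e \<tau> \<xi> \<gamma> = F.side (fm \<xi>) (fp \<gamma>)"
      unfolding g_minus_def v by (rule F.combination_at_eq_side[OF m nm])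
    show "- F.side (fp \<xi>) (fp \<gamma>) = F.side (fm \<xi>) (fm \<gamma>)"
      using F.minus_side[OF p np] unfolding minus .
    show "- F.side (fm \<xi>) (fp \<gamma>) = F.side (fp \<xi>) (fm \<gamma>)"
      using F.minus_side[OF m nm] unfolding minus .
  qed
  \<comment> \<open>Negation flips both signs, so the sides over the facets of
    \<open>fm \<gamma>\<close> are the negatives of those over \<open>fp \<gamma>\<close>; the four
    sign choices give \<open>g\<^sup>+\<close>, \<open>g\<^sup>-\<close> and their
    negatives.\<close>
  have "F.sides = (\<Union>\<gamma>\<in>Field r. \<Union>\<xi>\<in>Field r - {\<gamma>}. {F.side (fp \<xi>) (fp \<gamma>), F.side (fm \<xi>) (fm \<gamma>),
      F.side (fm \<xi>) (fp \<gamma>), F.side (fp \<xi>) (fm \<gamma>)})" (is "_ = ?S")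
  proof (intro equalityI subsetI)
    fix f assume "f \<in> F.sides"
    then obtain \<phi> \<psi> where f: "f = F.side \<phi> \<psi>" and p: "\<phi> \<in> minimal_boundary" "\<psi> \<in> minimal_boundary"
      and ne: "\<phi> \<noteq> \<psi>" "\<phi> \<noteq> - \<psi>" by (rule F.sidesE)
    obtain \<xi> where \<xi>: "\<xi> \<in> Field r" "\<phi> = fp \<xi> \<or> \<phi> = fm \<xi>" using C.minimal_boundaryE[OF p(1)] by metis
    obtain \<gamma> where \<gamma>: "\<gamma> \<in> Field r" "\<psi> = fp \<gamma> \<or> \<psi> = fm \<gamma>" using C.minimal_boundaryE[OF p(2)] by metis
    have "\<xi> \<noteq> \<gamma>" using ne \<xi> \<gamma> by (auto simp: C.minus_fp C.minus_fm)
    with \<xi>(1) have "\<xi> \<in> Field r - {\<gamma>}" by simp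
    moreover have "f \<in> {F.side (fp \<xi>) (fp \<gamma>), F.side (fm \<xi>) (fm \<gamma>), F.side (fm \<xi>) (fp \<gamma>), F.side (fp \<xi>) (fm \<gamma>)}"
      using \<xi>(2) \<gamma>(2) f by blast
    ultimately show "f \<in> ?S" by (intro UN_I[OF \<gamma>(1)] UN_I)
  next
    fix f assume "f \<in> ?S"
    then obtain \<gamma> \<xi> where i: "\<gamma> \<in> Field r" "\<xi> \<in> Field r" "\<xi> \<noteq> \<gamma>"
      and "f \<in> {F.side (fp \<xi>) (fp \<gamma>), F.side (fm \<xi>) (fm \<gamma>), F.side (fm \<xi>) (fp \<gamma>), F.side (fp \<xi>) (fm \<gamma>)}"
      by (elim UN_E DiffE) simp
    then obtain \<phi> \<psi> where f: "f = F.side \<phi> \<psi>"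
      and e: "\<phi> = fp \<xi> \<or> \<phi> = fm \<xi>" "\<psi> = fp \<gamma> \<or> \<psi> = fm \<gamma>" by blast
    have "\<phi> \<in> minimal_boundary" "\<psi> \<in> minimal_boundary" using e i C.fp_minimal C.fm_minimal by auto
    then show "f \<in> F.sides" unfolding f using side_cond[OF i e] by (intro F.sidesI) auto
  qed
  also have "\<dots> = new_functionals r fp fm e \<tau>"
    unfolding new_functionals_def by (intro SUP_cong refl) (simp add: g)
  finally have sides: "F.sides = new_functionals r fp fm e \<tau>" .
  show ?thesis
    unfolding new_norm_def sides[symmetric]
    by (intro conjI F.property_V_sides F.equivalent_norm_gauge F.V_polyhedral_gauge
        is_banach_norm_if_equivalent[OF F.equivalent_norm_gauge]) (simp add: F.gauge_le_one_iff)
qed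

end
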